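(* A group satisfies the translate property for sets if and only if it is supramenable.
   Context: For a function $f$ on a group $G$ and $g\in G$, $(gf)(x)=f(g^{-1}x)$. A non-zero bounded function $f\geq0$ on $G$ satisfies the translate property if for all $n$, $t_1,\dots,t_n\in\mathbf{R}$ and $g_1,\dots,g_n\in G$: $\sum_{i=1}^n t_i g_i f\geq 0$ (pointwise on $G$) implies $\sum_{i=1}^n t_i\geq0$. The group $G$ satisfies the translate property for sets if the characteristic function $f=\boldsymbol{1}_A$ satisfies the translate property for every non-empty subset $A\subseteq G$. A group $G$ is supramenable if for every $G$-set $X$ and every non-empty subset $A\subseteq X$ there is a $G$-invariant finitely additive measure $\mu$ defined on all subsets of $X$, with values in $[0,\infty]$, such that $\mu(A)=1$. *)

theory Defs
  imports "HOL-Analysis.Analysis" "HOL-Algebra.Group_Action"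
begin

definition translate :: "('a, 'm) monoid_scheme \<Rightarrow> 'a \<Rightarrow> ('a \<Rightarrow> real) \<Rightarrow> 'a \<Rightarrow> real"
  where "translate G g f = (\<lambda>x. f (inv\<^bsub>G\<^esub> g \<otimes>\<^bsub>G\<^esub> x))"

(* A function on G is represented by a HOL function of which only the values on carrier G matter. *)
definition translate_property :: "('a, 'm) monoid_scheme \<Rightarrow> ('a \<Rightarrow> real) \<Rightarrow> bool"
  where "translate_property G f \<longleftrightarrow>
    (\<forall>x\<in>carrier G. 0 \<le> f x) \<and> bounded (f ` carrier G) \<and> (\<exists>x\<in>carrier G. f x \<noteq> 0) \<and>
    (\<forall>(n::nat) (t :: nat \<Rightarrow> real) (g :: nat \<Rightarrow> 'a). (\<forall>i\<in>{1..n}. g i \<in> carrier G) \<longrightarrow>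
       (\<forall>x\<in>carrier G. 0 \<le> (\<Sum>i=1..n. t i * translate G (g i) f x)) \<longrightarrow>
       0 \<le> (\<Sum>i=1..n. t i))"

definition translate_property_for_sets :: "('a, 'm) monoid_scheme \<Rightarrow> bool"
  where "translate_property_for_sets G \<longleftrightarrow>
    (\<forall>A. A \<subseteq> carrier G \<and> A \<noteq> {} \<longrightarrow> translate_property G (indicator A))"

definition invariant_fin_add_measure ::
    "('a, 'm) monoid_scheme \<Rightarrow> 'x set \<Rightarrow> ('a \<Rightarrow> 'x \<Rightarrow> 'x) \<Rightarrow> ('x set \<Rightarrow> ennreal) \<Rightarrow> bool"
  where "invariant_fin_add_measure G X \<phi> \<mu> \<longleftrightarrow>
    positive (Pow X) \<mu> \<and> additive (Pow X) \<mu> \<and>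
    (\<forall>g\<in>carrier G. \<forall>B\<subseteq>X. \<mu> (\<phi> g ` B) = \<mu> B)"

(* HOL cannot quantify over types inside a formula, so the type 'x that the G-sets are drawn from
   is a parameter. Only types large enough to contain a copy of G are meaningful here: over the
   unit type, say, the condition holds for every group. Taking
   the type 'a + 'x, with 'a the type of the group elements and 'x arbitrary, provides such a copy and
   includes every G-set on 'x, so that no G-set is lost as 'x varies. *)
definition supramenable :: "'x itself \<Rightarrow> ('a, 'm) monoid_scheme \<Rightarrow> bool"
  where "supramenable (_ :: 'x itself) G \<longleftrightarrow>
    (\<forall>(X :: 'x set) \<phi> A. group_action G X \<phi> \<and> A \<subseteq> X \<and> A \<noteq> {} \<longrightarrow>
       (\<exists>\<mu>. invariant_fin_add_measure G X \<phi> \<mu> \<and> \<mu> A = 1))"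

end

theory Submission
  imports Defs "HOL-Real_Asymp.Real_Asymp"
begin

text \<open>
  From supramenability to the translate property: let \<open>\<mu>\<close> be an invariant measure for the regular
  action with \<open>\<mu> A = 1\<close>. All translates of \<open>A\<close> have measure \<open>1\<close>, so integrating
  \<open>\<Sum> t\<^sub>i g\<^sub>i 1\<^sub>A \<ge> 0\<close> against \<open>\<mu>\<close> gives \<open>\<Sum> t\<^sub>i \<ge> 0\<close>.

  Conversely, the translate property of a single set \<open>A\<close> gives, by a Hahn--Banach argument, a positive
  functional that takes the value \<open>1\<close> at every translate of \<open>1\<^sub>A\<close>. It need not be invariant, but it can
  be chosen invariant if \<open>G\<close> is amenable. The measure obtained in this way on \<open>G\<close> is then
  transported to an arbitrary \<open>G\<close>-set along an orbit map. It remains to see that the translate property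
  for sets forces amenability, in Reiter's form: for every finite \<open>S\<close> there are finitely supported
  probability densities \<open>\<theta>\<close> on \<open>G\<close> whose right translates by elements of \<open>S\<close> are close to
  \<open>\<theta>\<close> in \<open>l\<^sup>1\<close>.

  This is proved by adding the elements of \<open>S\<close> one at a time. Let \<open>\<alpha>\<close> be almost invariant under
  \<open>S\<close>, and let \<open>\<beta>\<close> be the uniform density on a long segment \<open>1, g, \<dots>, g\<^sup>n\<^sup>-\<^sup>1\<close>, which is almost
  invariant under \<open>g\<close>. Left translation does not affect right almost invariance. Hence if a convex
  combination of left translates of \<open>u = \<alpha> - \<beta>\<close> is small in \<open>l\<^sup>1\<close>, then the same combination of
  translates of \<open>\<alpha>\<close> is almost invariant under both \<open>S\<close> and \<open>g\<close>. If there is no such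
  combination, then Hahn--Banach provides a function \<open>h\<close> with values in \<open>[0, 1]\<close> such that
  \<open>\<Sum>\<^sub>g u(g) g h \<ge> \<delta> > 0\<close> everywhere, although \<open>\<Sum>\<^sub>g u(g) = 0\<close>: the function \<open>h\<close> violates the
  translate property.

  To obtain a set that violates it, average this inequality over the translates by \<open>n\<close> distinct elements.
  Each coefficient then has size \<open>O(1/n)\<close>. If \<open>A\<close> is a random set that contains \<open>x\<close> with
  probability \<open>h(x)\<close>, independently for all \<open>x\<close>, then the averaged sum for \<open>1\<^sub>A\<close> drops
  below \<open>\<delta> / 2\<close> at a given point with probability exponentially small in \<open>n\<close>, while each point of \<open>G\<close> is involved
  in only \<open>O(n)\<close> of the inequalities. A local counting argument due to Rosenfeld, in the spirit of the
  Lovasz local lemma, shows that finitely many of them can be satisfied simultaneously, and compactness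
  of the space of subsets handles all of them together
  (\<open>set_without_translate_property\<close>).
\<close>

section \<open>A Hahn--Banach theorem\<close>

text \<open>
  The pairs in \<open>D\<close> play the role of the bounds \<open>p f \<le> t\<close> for the sublinear functional
  \<open>p f = Inf {t. (f, t) \<in> D}\<close>. Working with the cone \<open>D\<close> instead of \<open>p\<close> makes the step of Zorn's
  lemma an inclusion of sets. For a maximal cone the functional \<open>p\<close> is linear, since otherwise the
  bound \<open>p (- f) \<le> - p f\<close> could be added to it.
\<close>
lemma cone_dominated_linear_functional:
  fixes E :: "('a \<Rightarrow> real) set" and D :: "(('a \<Rightarrow> real) \<times> real) set"
  assumes E_add: "\<And>f g. f \<in> E \<Longrightarrow> g \<in> E \<Longrightarrow> (\<lambda>x. f x + g x) \<in> E"
    and E_scale: "\<And>f c. f \<in> E \<Longrightarrow> (\<lambda>x. c * f x) \<in> E"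
    and D_E: "\<And>f t. (f, t) \<in> D \<Longrightarrow> f \<in> E"
    and D_add: "\<And>f g t r. (f, t) \<in> D \<Longrightarrow> (g, r) \<in> D \<Longrightarrow> (\<lambda>x. f x + g x, t + r) \<in> D"
    and D_scale: "\<And>f t c. (f, t) \<in> D \<Longrightarrow> 0 \<le> c \<Longrightarrow> (\<lambda>x. c * f x, c * t) \<in> D"
    and D_ex: "\<And>f. f \<in> E \<Longrightarrow> \<exists>t. (f, t) \<in> D"
    and D_pos: "\<And>t. (\<lambda>x. 0, t) \<in> D \<Longrightarrow> 0 \<le> t"
  obtains L where "\<And>f g. f \<in> E \<Longrightarrow> g \<in> E \<Longrightarrow> L (\<lambda>x. f x + g x) = L f + L g"
    and "\<And>f c. f \<in> E \<Longrightarrow> L (\<lambda>x. c * f x) = c * L f"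
    and "\<And>f t. (f, t) \<in> D \<Longrightarrow> L f \<le> t"
proof -
  define cone where "cone M \<longleftrightarrow> D \<subseteq> M \<and> (\<forall>f t. (f, t) \<in> M \<longrightarrow> f \<in> E) \<and>
      (\<forall>f g t r. (f, t) \<in> M \<longrightarrow> (g, r) \<in> M \<longrightarrow> (\<lambda>x. f x + g x, t + r) \<in> M) \<and>
      (\<forall>f t c. (f, t) \<in> M \<longrightarrow> 0 \<le> c \<longrightarrow> (\<lambda>x. c * f x, c * t) \<in> M) \<and>
      (\<forall>t. (\<lambda>x. 0, t) \<in> M \<longrightarrow> 0 \<le> t)" for M
  have "cone D"
    unfolding cone_def using assms by blast
  have Un: "cone (\<Union>\<C>)" if "\<C> \<noteq> {}" and ch: "subset.chain {M. cone M} \<C>" for \<C>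
  proof -
    have c: "cone M" if "M \<in> \<C>" for M
      using ch that by (auto simp: subset.chain_def)
    have tot: "M \<subseteq> N \<or> N \<subseteq> M" if "M \<in> \<C>" "N \<in> \<C>" for M N
      using ch that by (auto simp: subset_chain_def)
    have "(\<lambda>x. f x + g x, t + r) \<in> \<Union>\<C>" if f: "(f, t) \<in> \<Union>\<C>" and g: "(g, r) \<in> \<Union>\<C>" for f g t r
    proof -
      obtain M N where MN: "M \<in> \<C>" "(f, t) \<in> M" "N \<in> \<C>" "(g, r) \<in> N"
        using f g by blast
      then obtain K where K: "K \<in> \<C>" "(f, t) \<in> K" "(g, r) \<in> K"
        using tot by blast
      then show ?thesis
        using c[OF K(1)] unfolding cone_def by blast
    qed
    moreover have "D \<subseteq> \<Union>\<C>"
      using that(1) c unfolding cone_def by blast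
    moreover have "\<forall>f t. (f, t) \<in> \<Union>\<C> \<longrightarrow> f \<in> E"
      using c unfolding cone_def by blast
    moreover have "\<forall>f t c. (f, t) \<in> \<Union>\<C> \<longrightarrow> 0 \<le> c \<longrightarrow> (\<lambda>x. c * f x, c * t) \<in> \<Union>\<C>"
      using c unfolding cone_def by blast
    moreover have "\<forall>t. (\<lambda>x. 0, t) \<in> \<Union>\<C> \<longrightarrow> 0 \<le> t"
      using c unfolding cone_def by blast
    ultimately show ?thesis
      unfolding cone_def by blast
  qed
  obtain M where M: "cone M" and max: "\<And>N. cone N \<Longrightarrow> M \<subseteq> N \<Longrightarrow> N = M"
    using subset_Zorn_nonempty[of "{M. cone M}"] \<open>cone D\<close> Un by blast
  have DM: "D \<subseteq> M" and M_E: "\<And>f t. (f, t) \<in> M \<Longrightarrow> f \<in> E"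
    and M_add: "\<And>f g t r. (f, t) \<in> M \<Longrightarrow> (g, r) \<in> M \<Longrightarrow> (\<lambda>x. f x + g x, t + r) \<in> M"
    and M_scale: "\<And>f t c. (f, t) \<in> M \<Longrightarrow> 0 \<le> c \<Longrightarrow> (\<lambda>x. c * f x, c * t) \<in> M"
    and M_pos: "\<And>t. (\<lambda>x. 0, t) \<in> M \<Longrightarrow> 0 \<le> t"
    using M unfolding cone_def by blast+
  have E_neg: "(\<lambda>x. - f x) \<in> E" if "f \<in> E" for f
    using E_scale[OF that, of "-1"] by simp
  define L where "L f = Inf {t. (f, t) \<in> M}" for f
  have opp: "0 \<le> t + r" if "(f, t) \<in> M" "(\<lambda>x. - f x, r) \<in> M" for f t r
    using M_add[OF that] M_pos by simp
  have bdd: "bdd_below {t. (f, t) \<in> M}" if f: "f \<in> E" for f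
  proof -
    obtain r where "(\<lambda>x. - f x, r) \<in> M"
      using D_ex[OF E_neg[OF f]] DM by blast
    then show ?thesis
      by (intro bdd_belowI[of _ "- r"]) (use opp in force)
  qed
  have L_le: "L f \<le> t" if "(f, t) \<in> M" for f t
    unfolding L_def using that bdd[OF M_E[OF that]] by (intro cInf_lower) auto
  have le_L: "r \<le> L f" if "f \<in> E" "\<And>t. (f, t) \<in> M \<Longrightarrow> r \<le> t" for f r
    unfolding L_def using that D_ex[OF that(1)] DM by (intro cInf_greatest) auto
  have neg: "(\<lambda>x. - f x, - L f) \<in> M" if f: "f \<in> E" for f
  proof -
    \<comment> \<open>the cone that is generated by \<open>M\<close> and the pair \<open>(- f, - L f)\<close>\<close>
    define N where "N = {(h, t - c * L f) | h t c. h \<in> E \<and> 0 \<le> c \<and> (\<lambda>x. h x + c * f x, t) \<in> M}"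
    have "M \<subseteq> N"
    proof clarify
      fix h t assume "(h, t) \<in> M"
      then show "(h, t) \<in> N"
        unfolding N_def using M_E by (intro CollectI exI[of _ h] exI[of _ t] exI[of _ 0]) auto
    qed
    moreover have "cone N"
      unfolding cone_def
    proof (intro conjI allI impI)
      show "D \<subseteq> N" using DM \<open>M \<subseteq> N\<close> by blast
      show "g \<in> E" if "(g, t) \<in> N" for g t using that by (auto simp: N_def)
    next
      fix g h t r assume "(g, t) \<in> N" "(h, r) \<in> N"
      then obtain t' c r' d where *: "g \<in> E" "h \<in> E" "t = t' - c * L f" "r = r' - d * L f"
          "0 \<le> c" "0 \<le> d" "(\<lambda>x. g x + c * f x, t') \<in> M" "(\<lambda>x. h x + d * f x, r') \<in> M"
        by (auto simp: N_def)
      have "(\<lambda>x. (g x + h x) + (c + d) * f x, t' + r') \<in> M"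
        using M_add[OF *(7,8)] by (simp add: algebra_simps)
      then show "(\<lambda>x. g x + h x, t + r) \<in> N"
        unfolding N_def using * E_add
        by (intro CollectI exI[of _ "\<lambda>x. g x + h x"] exI[of _ "t' + r'"] exI[of _ "c + d"])
          (auto simp: algebra_simps)
    next
      fix g t and k :: real assume "(g, t) \<in> N" "0 \<le> k"
      then obtain t' c where *: "g \<in> E" "t = t' - c * L f" "0 \<le> c" "(\<lambda>x. g x + c * f x, t') \<in> M"
        by (auto simp: N_def)
      have "(\<lambda>x. k * g x + (k * c) * f x, k * t') \<in> M"
        using M_scale[OF *(4) \<open>0 \<le> k\<close>] by (simp add: algebra_simps)
      then show "(\<lambda>x. k * g x, k * t) \<in> N"
        unfolding N_def using * E_scale \<open>0 \<le> k\<close>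
        by (intro CollectI exI[of _ "\<lambda>x. k * g x"] exI[of _ "k * t'"] exI[of _ "k * c"])
          (auto simp: algebra_simps)
    next
      fix t assume "(\<lambda>x. 0, t) \<in> N"
      then obtain t' c where *: "t = t' - c * L f" "0 \<le> c" "(\<lambda>x. c * f x, t') \<in> M"
        by (auto simp: N_def)
      show "0 \<le> t"
      proof (cases "c = 0")
        case True
        then show ?thesis using * M_pos by simp
      next
        case False
        then have "(f, t' / c) \<in> M"
          using M_scale[OF *(3), of "1 / c"] * by simp
        then have "L f \<le> t' / c" by (rule L_le)
        then show ?thesis using * False by (simp add: field_simps)
      qed
    qed
    ultimately have "N = M" using max by blast
    have "(\<lambda>x. 0, 0) \<in> M"
      using D_ex[OF f] M_scale[of f _ 0] DM by force
    then have "(\<lambda>x. - f x, 0 - 1 * L f) \<in> N"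
      unfolding N_def using E_neg[OF f]
      by (intro CollectI exI[of _ "\<lambda>x. - f x"] exI[of _ 0] exI[of _ 1]) auto
    then show ?thesis using \<open>N = M\<close> by simp
  qed
  have L_neg: "L (\<lambda>x. - f x) = - L f" if f: "f \<in> E" for f
  proof (rule antisym)
    show "L (\<lambda>x. - f x) \<le> - L f" using neg[OF f] by (rule L_le)
    have "- r \<le> L f" if "(\<lambda>x. - f x, r) \<in> M" for r
      using opp that by (intro le_L[OF f]) force
    then show "- L f \<le> L (\<lambda>x. - f x)"
      by (intro le_L[OF E_neg[OF f]]) force
  qed
  have in_M: "(f, L f) \<in> M" if f: "f \<in> E" for f
    using neg[OF E_neg[OF f]] L_neg[OF f] by simp
  have sub: "L (\<lambda>x. f x + g x) \<le> L f + L g" if "f \<in> E" "g \<in> E" for f g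
    using M_add[OF in_M in_M] that L_le by blast
  have add: "L (\<lambda>x. f x + g x) = L f + L g" if "f \<in> E" "g \<in> E" for f g
    using sub[OF that] sub[OF E_add[OF that] E_neg[OF that(2)]] L_neg[OF that(2)] by simp
  have scale_le: "L (\<lambda>x. c * f x) \<le> c * L f" if "f \<in> E" "0 \<le> c" for f c
    using M_scale[OF in_M] that L_le by blast
  have scale_nonneg: "L (\<lambda>x. c * f x) = c * L f" if "f \<in> E" "0 \<le> c" for f c
    using scale_le[OF that] scale_le[OF E_neg that(2), OF that(1)]
      L_neg[OF E_scale[OF that(1), of c]] L_neg[OF that(1)] by simp
  have scale: "L (\<lambda>x. c * f x) = c * L f" if "f \<in> E" for f c
  proof (cases "0 \<le> c")
    case True
    then show ?thesis using scale_nonneg that by blast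
  next
    case False
    then show ?thesis
      using scale_nonneg[OF that, of "- c"] L_neg[OF E_scale[OF that, of "- c"]] by simp
  qed
  show ?thesis
    using that add scale L_le DM by blast
qed

section \<open>Rounding a function to a set\<close>

text \<open>
  The probability that a random subset of \<open>V\<close>, which contains each \<open>v\<close> independently with probability
  \<open>h v\<close>, equals \<open>B\<close>.
\<close>
definition bernoulli_weight :: "('v \<Rightarrow> real) \<Rightarrow> 'v set \<Rightarrow> 'v set \<Rightarrow> real"
  where "bernoulli_weight h V B = prod h B * (\<Prod>v\<in>V - B. 1 - h v)"

lemma bernoulli_weight_nonneg:
  assumes "\<And>v. 0 \<le> h v \<and> h v \<le> 1"
  shows "0 \<le> bernoulli_weight h V B"
  unfolding bernoulli_weight_def using assms by (intro mult_nonneg_nonneg prod_nonneg) auto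

text \<open>Independence of the traces of the random set on two disjoint sets of points.\<close>
lemma sum_bernoulli_weight_product:
  assumes fin: "finite V" "finite W" and disj: "V \<inter> W = {}"
  shows "(\<Sum>B\<in>Pow (V \<union> W). bernoulli_weight h (V \<union> W) B * (F (B \<inter> V) * K (B \<inter> W))) =
    (\<Sum>B\<in>Pow V. bernoulli_weight h V B * F B) * (\<Sum>B\<in>Pow W. bernoulli_weight h W B * K B)"
proof -
  have w: "bernoulli_weight h (V \<union> W) (B \<union> C) = bernoulli_weight h V B * bernoulli_weight h W C"
    if B: "B \<subseteq> V" and C: "C \<subseteq> W" for B C
  proof -
    have "V \<union> W - (B \<union> C) = (V - B) \<union> (W - C)" using B C disj by blast
    moreover have "prod h (B \<union> C) = prod h B * prod h C"
      using B C disj fin by (intro prod.union_disjoint) (auto intro: finite_subset)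
    moreover have "(\<Prod>v\<in>(V - B) \<union> (W - C). 1 - h v) = (\<Prod>v\<in>V - B. 1 - h v) * (\<Prod>v\<in>W - C. 1 - h v)"
      using disj fin by (intro prod.union_disjoint) auto
    ultimately show ?thesis by (simp add: bernoulli_weight_def)
  qed
  have "(\<Sum>B\<in>Pow (V \<union> W). bernoulli_weight h (V \<union> W) B * (F (B \<inter> V) * K (B \<inter> W))) =
      (\<Sum>(B, C)\<in>Pow V \<times> Pow W. bernoulli_weight h (V \<union> W) (B \<union> C) * (F B * K C))"
  proof (rule sum.reindex_bij_witness[of _ "\<lambda>(B, C). B \<union> C" "\<lambda>B. (B \<inter> V, B \<inter> W)"])
    fix B assume "B \<in> Pow (V \<union> W)"
    then have "B \<inter> V \<union> B \<inter> W = B" by blast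
    then show "(case (B \<inter> V, B \<inter> W) of (B, C) \<Rightarrow> B \<union> C) = B"
      and "(case (B \<inter> V, B \<inter> W) of (B, C) \<Rightarrow> bernoulli_weight h (V \<union> W) (B \<union> C) * (F B * K C)) =
        bernoulli_weight h (V \<union> W) B * (F (B \<inter> V) * K (B \<inter> W))"
      by simp_all
  qed (use disj in auto)
  also have "\<dots> = (\<Sum>(B, C)\<in>Pow V \<times> Pow W. (bernoulli_weight h V B * F B) * (bernoulli_weight h W C * K C))"
    by (intro sum.cong) (auto simp: w)
  also have "\<dots> = (\<Sum>B\<in>Pow V. bernoulli_weight h V B * F B) * (\<Sum>B\<in>Pow W. bernoulli_weight h W B * K B)"
    by (simp add: sum_product sum.cartesian_product)
  finally show ?thesis .
qed

lemma sum_bernoulli_weight: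
  assumes "finite V"
  shows "(\<Sum>B\<in>Pow V. bernoulli_weight h V B) = 1"
  using prod_add[OF assms, of h "\<lambda>v. 1 - h v"] by (simp add: bernoulli_weight_def)

text \<open>
  The moment generating function is a product over the points of \<open>V\<close>. For each factor the linear terms
  of \<open>exp t \<le> 1 + t + t\<^sup>2\<close> cancel, because the random variable has mean \<open>0\<close>.
\<close>
lemma sum_bernoulli_weight_exp_le:
  fixes a h :: "'v \<Rightarrow> real"
  assumes fin: "finite V" and h: "\<And>v. 0 \<le> h v \<and> h v \<le> 1"
    and a: "\<And>v. v \<in> V \<Longrightarrow> \<bar>a v\<bar> \<le> 1"
  shows "(\<Sum>B\<in>Pow V. bernoulli_weight h V B * exp (\<Sum>v\<in>V. a v * (h v - indicator B v)))
    \<le> exp (\<Sum>v\<in>V. (a v)\<^sup>2)"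
proof -
  have "bernoulli_weight h V B * exp (\<Sum>v\<in>V. a v * (h v - indicator B v)) =
      (\<Prod>v\<in>B. h v * exp (- (a v * (1 - h v)))) * (\<Prod>v\<in>V - B. (1 - h v) * exp (a v * h v))"
    if "B \<in> Pow V" for B
  proof -
    have "(\<Sum>v\<in>V. a v * (h v - indicator B v)) =
        (\<Sum>v\<in>B. - (a v * (1 - h v))) + (\<Sum>v\<in>V - B. a v * h v)"
      using that fin sum.subset_diff[of B V "\<lambda>v. a v * (h v - indicator B v)"]
      by (simp add: right_diff_distrib add.commute)
    then have "exp (\<Sum>v\<in>V. a v * (h v - indicator B v)) =
        (\<Prod>v\<in>B. exp (- (a v * (1 - h v)))) * (\<Prod>v\<in>V - B. exp (a v * h v))"
      using that fin by (simp only: exp_add) (simp add: exp_sum finite_subset[of B V])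
    then show ?thesis
      unfolding bernoulli_weight_def prod.distrib by (simp only: mult_ac)
  qed
  then have "(\<Sum>B\<in>Pow V. bernoulli_weight h V B * exp (\<Sum>v\<in>V. a v * (h v - indicator B v))) =
      (\<Prod>v\<in>V. h v * exp (- (a v * (1 - h v))) + (1 - h v) * exp (a v * h v))"
    by (subst prod_add[OF fin]) simp
  also have "\<dots> \<le> (\<Prod>v\<in>V. exp ((a v)\<^sup>2))"
  proof (rule prod_mono, intro conjI)
    fix v assume v: "v \<in> V"
    have hv: "0 \<le> h v" "h v \<le> 1" using h by auto
    show "0 \<le> h v * exp (- (a v * (1 - h v))) + (1 - h v) * exp (a v * h v)"
      using hv by simp
    have e: "exp t \<le> 1 + t + t\<^sup>2" if "\<bar>t\<bar> \<le> 1" for t :: real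
    proof (cases "0 \<le> t")
      case True
      then show ?thesis using that exp_bound[of t] by simp
    next
      case False
      have "1 \<le> 1 + t\<^sup>2 / 2 * (1 - t + t\<^sup>2)"
        using False by (simp add: add_increasing)
      also have "\<dots> = (1 + t + t\<^sup>2) * (1 - t + t\<^sup>2 / 2)"
        by (simp add: algebra_simps power2_eq_square add_divide_distrib diff_divide_distrib)
      also have "\<dots> \<le> (1 + t + t\<^sup>2) * exp (- t)"
        using exp_lower_Taylor_quadratic[of "- t"] False that by (intro mult_left_mono) auto
      finally show ?thesis by (simp add: exp_minus field_simps)
    qed
    have "\<bar>a v * (1 - h v)\<bar> \<le> 1 * 1" "\<bar>a v * h v\<bar> \<le> 1 * 1"
      unfolding abs_mult using a[OF v] hv by (intro mult_mono; simp)+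
    then have "h v * exp (- (a v * (1 - h v))) + (1 - h v) * exp (a v * h v)
      \<le> h v * (1 + - (a v * (1 - h v)) + (- (a v * (1 - h v)))\<^sup>2) + (1 - h v) * (1 + a v * h v + (a v * h v)\<^sup>2)"
      using hv by (intro add_mono mult_left_mono e) auto
    also have "\<dots> = 1 + (a v)\<^sup>2 * (h v * (1 - h v))"
      by (simp add: algebra_simps power2_eq_square)
    also have "\<dots> \<le> 1 + (a v)\<^sup>2 * 1"
      using hv by (intro add_left_mono mult_left_mono mult_le_one) auto
    also have "\<dots> \<le> exp ((a v)\<^sup>2)"
      using exp_ge_add_one_self[of "(a v)\<^sup>2"] by simp
    finally show "h v * exp (- (a v * (1 - h v))) + (1 - h v) * exp (a v * h v) \<le> exp ((a v)\<^sup>2)" .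
  qed
  also have "\<dots> = exp (\<Sum>v\<in>V. (a v)\<^sup>2)"
    using fin by (simp add: exp_sum)
  finally show ?thesis .
qed

text \<open>Chernoff's bound. The parameter \<open>r\<close> is left free, to be optimised later.\<close>
lemma bernoulli_deviation_le:
  fixes a h :: "'v \<Rightarrow> real"
  assumes fin: "finite V" and h: "\<And>v. 0 \<le> h v \<and> h v \<le> 1" and r: "0 \<le> r"
    and a: "\<And>v. v \<in> V \<Longrightarrow> \<bar>r * a v\<bar> \<le> 1"
  shows "(\<Sum>B\<in>{B \<in> Pow V. (\<Sum>v\<in>V. a v * (indicator B v - h v)) < - \<eta>}. bernoulli_weight h V B)
    \<le> exp (r\<^sup>2 * (\<Sum>v\<in>V. (a v)\<^sup>2) - r * \<eta>)"
proof -
  have "(\<Sum>B\<in>{B \<in> Pow V. (\<Sum>v\<in>V. a v * (indicator B v - h v)) < - \<eta>}. bernoulli_weight h V B)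
    \<le> (\<Sum>B\<in>{B \<in> Pow V. (\<Sum>v\<in>V. a v * (indicator B v - h v)) < - \<eta>}.
        bernoulli_weight h V B * (exp (\<Sum>v\<in>V. (r * a v) * (h v - indicator B v)) * exp (- (r * \<eta>))))"
  proof (rule sum_mono)
    fix B assume "B \<in> {B \<in> Pow V. (\<Sum>v\<in>V. a v * (indicator B v - h v)) < - \<eta>}"
    then have "\<eta> \<le> - (\<Sum>v\<in>V. a v * (indicator B v - h v))" by simp
    also have "\<dots> = (\<Sum>v\<in>V. a v * (h v - indicator B v))"
      by (simp add: sum_negf[symmetric] algebra_simps)
    finally have "r * \<eta> \<le> (\<Sum>v\<in>V. (r * a v) * (h v - indicator B v))"
      using mult_left_mono[OF _ r, of \<eta>] by (metis (no_types, lifting) mult.assoc sum.cong sum_distrib_left)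
    then have "1 \<le> exp (\<Sum>v\<in>V. (r * a v) * (h v - indicator B v)) * exp (- (r * \<eta>))"
      by (simp add: exp_add[symmetric])
    then show "bernoulli_weight h V B \<le>
      bernoulli_weight h V B * (exp (\<Sum>v\<in>V. (r * a v) * (h v - indicator B v)) * exp (- (r * \<eta>)))"
      using mult_left_mono[OF _ bernoulli_weight_nonneg[OF h]] by fastforce
  qed
  also have "\<dots> \<le> (\<Sum>B\<in>Pow V.
        bernoulli_weight h V B * (exp (\<Sum>v\<in>V. (r * a v) * (h v - indicator B v)) * exp (- (r * \<eta>))))"
    using fin bernoulli_weight_nonneg[of h, OF h] by (intro sum_mono2) auto
  also have "\<dots> = (\<Sum>B\<in>Pow V. bernoulli_weight h V B * exp (\<Sum>v\<in>V. (r * a v) * (h v - indicator B v)))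
      * exp (- (r * \<eta>))"
    by (simp add: sum_distrib_right mult.assoc)
  also have "\<dots> \<le> exp (\<Sum>v\<in>V. (r * a v)\<^sup>2) * exp (- (r * \<eta>))"
    using sum_bernoulli_weight_exp_le[OF fin h, of "\<lambda>v. r * a v"] a by (intro mult_right_mono) auto
  also have "\<dots> = exp (r\<^sup>2 * (\<Sum>v\<in>V. (a v)\<^sup>2) - r * \<eta>)"
    by (simp add: exp_add[symmetric] sum_distrib_left power_mult_distrib)
  finally show ?thesis .
qed

text \<open>
  Rosenfeld's counting method, as a substitute for the Lovasz local lemma. Let \<open>W V\<close> be the probability
  that the random subset of \<open>V\<close> satisfies all constraints that live inside \<open>V\<close>. Adding a point \<open>v\<close>
  can only violate constraints \<open>e i\<close> through \<open>v\<close>. By independence, the loss caused by one of them is at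
  most \<open>p * W (V - e i)\<close>, and removing the at most \<open>N\<close> points of \<open>e i\<close> from \<open>V\<close> has
  increased the probability by a factor of at most \<open>2\<close>, by induction. Hence each new point costs a factor of
  at most \<open>\<beta> = 1 - 1 / (2 * N)\<close>, and \<open>W V\<close> remains positive.
\<close>
lemma rosenfeld_counting:
  fixes h :: "'v \<Rightarrow> real" and e :: "'i \<Rightarrow> 'v set"
  assumes h: "\<And>v. 0 \<le> h v \<and> h v \<le> 1"
    and e: "\<And>i. i \<in> I \<Longrightarrow> finite (e i) \<and> e i \<noteq> {} \<and> card (e i) \<le> N"
    and deg: "\<And>v. finite {i\<in>I. v \<in> e i} \<and> card {i\<in>I. v \<in> e i} \<le> N"
    and bad: "\<And>i. i \<in> I \<Longrightarrow> (\<Sum>B\<in>{B \<in> Pow (e i). bad i B}. bernoulli_weight h (e i) B) \<le> p"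
    and p: "4 * (real N)\<^sup>2 * p \<le> 1" and N: "1 \<le> N"
    and V: "finite V"
  obtains B where "B \<subseteq> V" "\<And>i. i \<in> I \<Longrightarrow> e i \<subseteq> V \<Longrightarrow> \<not> bad i (B \<inter> e i)"
proof -
  define good where "good V B \<longleftrightarrow> (\<forall>i\<in>I. e i \<subseteq> V \<longrightarrow> \<not> bad i (B \<inter> e i))" for V B
  define W where "W V = (\<Sum>B\<in>Pow V. bernoulli_weight h V B * of_bool (good V B))" for V
  define \<beta> where "\<beta> = 1 - 1 / (2 * real N)"
  have \<beta>: "1 / 2 \<le> \<beta>" "\<beta> \<le> 1" using N by (auto simp: \<beta>_def field_simps)
  have \<beta>N: "1 / 2 \<le> \<beta> ^ N"
    using Bernoulli_inequality[of "- (1 / (2 * real N))" N] N by (simp add: \<beta>_def field_simps)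
  note w_nonneg = bernoulli_weight_nonneg[of h, OF h]
  have W_nonneg: "0 \<le> W U" for U
    unfolding W_def using w_nonneg by (intro sum_nonneg) auto
  have step: "\<beta> * W U \<le> W (insert v U)" if "finite U" "v \<notin> U" for U v
    using that
  proof (induction "card U" arbitrary: U v rule: less_induct)
    case less
    note [simp] = \<open>finite U\<close> \<open>v \<notin> U\<close>
    have shrink: "\<beta> ^ card X * W (U - X) \<le> W U" if "X \<subseteq> U" for X
    proof -
      have "finite X" using that less.prems finite_subset by blast
      then show ?thesis using that
      proof (induction X rule: finite_induct)
        case (insert y X)
        have "card (U - insert y X) < card U"
          using insert.prems by (intro psubset_card_mono) auto
        then have "\<beta> * W (U - insert y X) \<le> W (insert y (U - insert y X))"
          using less.hyps by simp
        also have "insert y (U - insert y X) = U - X"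
          using insert by blast
        finally have "\<beta> ^ card X * (\<beta> * W (U - insert y X)) \<le> \<beta> ^ card X * W (U - X)"
          using \<beta> by (intro mult_left_mono) auto
        then show ?case using insert by (simp add: mult.assoc mult.left_commute)
      qed simp
    qed
    define J where "J = {i\<in>I. v \<in> e i \<and> e i \<subseteq> insert v U}"
    have J: "finite J" "card J \<le> N"
    proof -
      have "J \<subseteq> {i\<in>I. v \<in> e i}" by (auto simp: J_def)
      then show "finite J" "card J \<le> N"
        using deg[of v] finite_subset card_mono by (blast, meson order_trans card_mono)
    qed
    \<comment> \<open>the probability that constraint \<open>i\<close> fails while those disjoint from it still hold\<close>
    define P where "P i = (\<Sum>B\<in>Pow (insert v U). bernoulli_weight h (insert v U) B *
        (of_bool (bad i (B \<inter> e i)) * of_bool (good (U - e i) (B \<inter> (U - e i)))))" for i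
    have P_le: "P i \<le> 2 * p * W U" if i: "i \<in> J" for i
    proof -
      have i': "i \<in> I" "v \<in> e i" "e i \<subseteq> insert v U" using i by (auto simp: J_def)
      have eq: "insert v U = e i \<union> (U - e i)" using i' by blast
      have "P i = (\<Sum>B\<in>Pow (e i). bernoulli_weight h (e i) B * of_bool (bad i B)) * W (U - e i)"
        unfolding P_def W_def
        using sum_bernoulli_weight_product[of "e i" "U - e i" h "\<lambda>B. of_bool (bad i B)" "\<lambda>B. of_bool (good (U - e i) B)"]
          e[OF i'(1)] eq by simp
      also have "(\<Sum>B\<in>Pow (e i). bernoulli_weight h (e i) B * of_bool (bad i B)) =
          (\<Sum>B\<in>{B \<in> Pow (e i). bad i B}. bernoulli_weight h (e i) B)"
        using e[OF i'(1)] by (intro sum.mono_neutral_cong_right) auto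
      finally have P: "P i \<le> p * W (U - e i)"
        using bad[OF i'(1)] W_nonneg by (simp add: mult_right_mono)
      have p0: "0 \<le> p"
        using bad[OF i'(1)] sum_nonneg[of "{B \<in> Pow (e i). bad i B}" "bernoulli_weight h (e i)"] w_nonneg
        by (meson order_trans)
      have "U - (e i - {v}) = U - e i" by auto
      then have sh: "\<beta> ^ card (e i - {v}) * W (U - e i) \<le> W U"
        using shrink[of "e i - {v}"] i'(2,3) by (simp add: subset_insert_iff)
      have "card (e i - {v}) \<le> N"
        using e[OF i'(1)] by (meson card_Diff1_le order_trans)
      then have "\<beta> ^ N \<le> \<beta> ^ card (e i - {v})"
        using \<beta> by (intro power_decreasing) auto
      then have "1 / 2 * W (U - e i) \<le> \<beta> ^ card (e i - {v}) * W (U - e i)"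
        using \<beta>N W_nonneg by (intro mult_right_mono) auto
      then have "W (U - e i) \<le> 2 * W U" using sh by simp
      then show ?thesis
        using P mult_left_mono[OF _ p0, of "W (U - e i)" "2 * W U"] by simp
    qed
    have "W U = (\<Sum>B\<in>Pow (insert v U). bernoulli_weight h (insert v U) B * of_bool (good U (B \<inter> U)))"
      using sum_bernoulli_weight_product[of U "{v}" h "\<lambda>B. of_bool (good U B)" "\<lambda>B. 1"]
        sum_bernoulli_weight[of "{v}" h]
      by (simp add: W_def)
    also have "\<dots> \<le> (\<Sum>B\<in>Pow (insert v U). bernoulli_weight h (insert v U) B *
        (of_bool (good (insert v U) B) + (\<Sum>i\<in>J. of_bool (bad i (B \<inter> e i)) * of_bool (good (U - e i) (B \<inter> (U - e i))))))"
    proof (intro sum_mono mult_left_mono w_nonneg)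
      fix B assume B: "B \<in> Pow (insert v U)"
      show "of_bool (good U (B \<inter> U)) \<le> of_bool (good (insert v U) B) +
        (\<Sum>i\<in>J. of_bool (bad i (B \<inter> e i)) * (of_bool (good (U - e i) (B \<inter> (U - e i))) :: real))"
        (is "_ \<le> _ + ?S")
      proof (cases "good U (B \<inter> U) \<and> \<not> good (insert v U) B")
        case False
        have "0 \<le> ?S" by (intro sum_nonneg) auto
        then show ?thesis using False by auto
      next
        case True
        then obtain i where i: "i \<in> I" "e i \<subseteq> insert v U" "bad i (B \<inter> e i)"
          by (auto simp: good_def)
        have "v \<in> e i"
        proof (rule ccontr)
          assume "v \<notin> e i"
          then have "e i \<subseteq> U" "B \<inter> U \<inter> e i = B \<inter> e i" using i by auto
          then show False using True i by (auto simp: good_def)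
        qed
        then have "i \<in> J" using i by (simp add: J_def)
        have "good (U - e i) (B \<inter> (U - e i))"
          unfolding good_def
        proof (intro ballI impI)
          fix j assume j: "j \<in> I" "e j \<subseteq> U - e i"
          then have "B \<inter> (U - e i) \<inter> e j = B \<inter> U \<inter> e j" by blast
          then show "\<not> bad j (B \<inter> (U - e i) \<inter> e j)"
            using True j unfolding good_def by auto
        qed
        then have "1 \<le> ?S"
          using member_le_sum[of i J "\<lambda>i. of_bool (bad i (B \<inter> e i)) * (of_bool (good (U - e i) (B \<inter> (U - e i))) :: real)"]
            \<open>i \<in> J\<close> i J by simp
        then show ?thesis using True by simp
      qed
    qed
    also have "\<dots> = W (insert v U) + (\<Sum>i\<in>J. P i)"
      unfolding W_def P_def
      by (simp add: distrib_left sum.distrib sum_distrib_left sum.swap[of _ J])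
    also have "\<dots> \<le> W (insert v U) + (\<Sum>i\<in>J. 2 * p * W U)"
      using P_le by (intro add_left_mono sum_mono)
    also have "\<dots> = W (insert v U) + real (card J) * (2 * p * W U)" by simp
    also have "\<dots> \<le> W (insert v U) + 1 / (2 * real N) * W U"
    proof (cases "J = {}")
      case True
      then show ?thesis using W_nonneg by simp
    next
      case False
      then obtain i where i: "i \<in> I" by (auto simp: J_def)
      have p0: "0 \<le> p"
        using bad[OF i] sum_nonneg[of "{B \<in> Pow (e i). bad i B}" "bernoulli_weight h (e i)"] w_nonneg
        by (meson order_trans)
      have "real (card J) * (2 * p) \<le> real N * (2 * p)"
        using J p0 by (intro mult_right_mono) auto
      also have "\<dots> \<le> 1 / (2 * real N)"
        using p N by (simp add: field_simps power2_eq_square)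
      finally have "real (card J) * (2 * p) * W U \<le> 1 / (2 * real N) * W U"
        using W_nonneg by (intro mult_right_mono)
      then show ?thesis by (simp add: mult.assoc)
    qed
    finally show ?case by (simp add: \<beta>_def algebra_simps)
  qed
  have "0 < W V" using V
  proof (induction V rule: finite_induct)
    case empty
    have "good {} {}" using e by (auto simp: good_def)
    then show ?case by (simp add: W_def bernoulli_weight_def)
  next
    case (insert v V)
    then have "0 < \<beta> * W V" using \<beta> by simp
    then show ?case using step[of V v] insert by simp
  qed
  then have "(\<Sum>B\<in>Pow V. bernoulli_weight h V B * of_bool (good V B)) \<noteq> 0"
    by (simp add: W_def)
  then obtain B where "B \<in> Pow V" "bernoulli_weight h V B * of_bool (good V B) \<noteq> 0"
    by (rule sum.not_neutral_contains_not_neutral)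
  then show ?thesis using that by (auto simp: good_def)
qed

text \<open>
  Each constraint depends on finitely many points only, so it defines a closed subset of the compact
  space of all subsets of the type.
\<close>
lemma finite_constraints_compactness:
  fixes e :: "'i \<Rightarrow> 'v set"
  assumes e: "\<And>i. i \<in> I \<Longrightarrow> finite (e i)"
    and fin: "\<And>J. finite J \<Longrightarrow> J \<subseteq> I \<Longrightarrow> \<exists>B. \<forall>i\<in>J. Q i (B \<inter> e i)"
  shows "\<exists>B. \<forall>i\<in>I. Q i (B \<inter> e i)"
proof -
  define X where "X = product_topology (\<lambda>_::'v. discrete_topology (UNIV :: bool set)) UNIV"
  define C where "C i = {f. Q i (Collect f \<inter> e i)}" for i
  have "compact_space X"
    unfolding X_def by (simp add: compact_space_product_topology compact_space_discrete_topology)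
  moreover have "closedin X (C i)" if i: "i \<in> I" for i
  proof -
    have 1: "closedin X {f. f v = b}" for v b
      using closedin_continuous_map_preimage[OF continuous_map_product_projection[of v UNIV "\<lambda>_. discrete_topology (UNIV :: bool set)"], of "{b}"]
      by (simp add: X_def)
    have 2: "closedin X {f. \<forall>v\<in>e i. f v = (v \<in> A)}" for A
    proof -
      have "{f. \<forall>v\<in>e i. f v = (v \<in> A)} = \<Inter>(insert UNIV ((\<lambda>v. {f. f v = (v \<in> A)}) ` e i))"
        by auto
      moreover have UNIV: "closedin X UNIV"
        using closedin_topspace[of X] by (simp add: X_def)
      moreover have "closedin X (\<Inter>(insert UNIV ((\<lambda>v. {f. f v = (v \<in> A)}) ` e i)))"
        using 1 UNIV by (intro closedin_Inter) blast+
      ultimately show ?thesis by simp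
    qed
    have "C i = (\<Union>A\<in>{A \<in> Pow (e i). Q i A}. {f. \<forall>v\<in>e i. f v = (v \<in> A)})"
    proof (intro Set.set_eqI iffI)
      fix f assume "f \<in> C i"
      then show "f \<in> (\<Union>A\<in>{A \<in> Pow (e i). Q i A}. {f. \<forall>v\<in>e i. f v = (v \<in> A)})"
        by (intro UN_I[of "Collect f \<inter> e i"]) (auto simp: C_def)
    next
      fix f assume "f \<in> (\<Union>A\<in>{A \<in> Pow (e i). Q i A}. {f. \<forall>v\<in>e i. f v = (v \<in> A)})"
      then obtain A where A: "A \<subseteq> e i" "Q i A" "\<forall>v\<in>e i. f v = (v \<in> A)" by auto
      then have "Collect f \<inter> e i = A" by auto
      then show "f \<in> C i" using A by (simp add: C_def)
    qed
    moreover have "closedin X (\<Union>A\<in>{A \<in> Pow (e i). Q i A}. {f. \<forall>v\<in>e i. f v = (v \<in> A)})"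
      using e[OF i] 2 by (intro closedin_Union) (simp, blast)
    ultimately show ?thesis by simp
  qed
  moreover have "\<Inter>\<F> \<noteq> {}" if \<F>: "finite \<F>" "\<F> \<subseteq> C ` I" for \<F>
  proof -
    obtain J where J: "finite J" "J \<subseteq> I" "\<F> = C ` J"
      using finite_subset_image[OF \<F>] by blast
    then obtain B where B: "\<forall>i\<in>J. Q i (B \<inter> e i)" using fin by blast
    then have "(\<lambda>v. v \<in> B) \<in> \<Inter>\<F>" using J by (simp add: C_def)
    then show ?thesis by blast
  qed
  ultimately have "\<Inter>(C ` I) \<noteq> {}"
    unfolding compact_space_fip by blast
  then obtain f where "\<forall>i\<in>I. f \<in> C i" by blast
  then show ?thesis by (auto simp: C_def)
qed

section \<open>Finite combinations of translates\<close>

text \<open>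
  Finite sums of weighted translates are encoded by lists, so that sums of combinations correspond to
  concatenation.
\<close>
definition combination :: "('a, 'm) monoid_scheme \<Rightarrow> (real \<times> 'a) list \<Rightarrow> ('a \<Rightarrow> real) \<Rightarrow> 'a \<Rightarrow> real"
  where "combination G xs f x = (\<Sum>(c, a)\<leftarrow>xs. c * translate G a f x)"

definition total_weight :: "(real \<times> 'a) list \<Rightarrow> real"
  where "total_weight xs = sum_list (map fst xs)"

definition rescale :: "real \<Rightarrow> (real \<times> 'a) list \<Rightarrow> (real \<times> 'a) list"
  where "rescale k xs = map (\<lambda>(c, a). (k * c, a)) xs"

lemma combination_simps [simp]:
  "combination G [] f x = 0"
  "combination G ((c, a) # xs) f x = c * translate G a f x + combination G xs f x"
  by (simp_all add: combination_def)

lemma combination_append [simp]: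
  "combination G (xs @ ys) f x = combination G xs f x + combination G ys f x"
  by (simp add: combination_def)

lemma combination_rescale [simp]:
  "combination G (rescale k xs) f x = k * combination G xs f x"
  by (induction xs) (auto simp: rescale_def algebra_simps)

lemma combination_diff:
  "combination G xs (\<lambda>x. f x - f' x) y = combination G xs f y - combination G xs f' y"
  by (induction xs) (auto simp: translate_def algebra_simps)

lemma total_weight_simps [simp]:
  "total_weight [] = 0" "total_weight ((c, a) # xs) = c + total_weight xs" "total_weight (xs @ ys) = total_weight xs + total_weight ys"
  "total_weight (rescale k xs) = k * total_weight xs"
  by (simp_all add: total_weight_def rescale_def) (induction xs, auto simp: algebra_simps)

lemma set_rescale: "set (rescale k xs) = (\<lambda>(c, a). (k * c, a)) ` set xs"
  by (auto simp: rescale_def)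

definition l1norm :: "('a, 'm) monoid_scheme \<Rightarrow> ('a \<Rightarrow> real) \<Rightarrow> real"
  where "l1norm G f = (\<Sum>\<^sub>\<infinity>x\<in>carrier G. \<bar>f x\<bar>)"

definition finsupp :: "('a, 'm) monoid_scheme \<Rightarrow> ('a \<Rightarrow> real) \<Rightarrow> bool"
  where "finsupp G f \<longleftrightarrow> finite {x \<in> carrier G. f x \<noteq> 0}"

lemma infsum_finsupp:
  assumes "finite F" "F \<subseteq> carrier G" "\<And>x. x \<in> carrier G - F \<Longrightarrow> f x = 0"
  shows "(\<Sum>\<^sub>\<infinity>x\<in>carrier G. f x) = (\<Sum>x\<in>F. f x :: real)"
proof -
  have "infsum f (carrier G) = infsum f F"
    using assms by (intro infsum_cong_neutral) auto
  then show ?thesis using assms by simp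
qed

lemma l1norm_eq_sum:
  assumes "finite F" "F \<subseteq> carrier G" "\<And>x. x \<in> carrier G - F \<Longrightarrow> f x = 0"
  shows "l1norm G f = (\<Sum>x\<in>F. \<bar>f x\<bar>)"
  unfolding l1norm_def using assms by (intro infsum_finsupp) auto

lemma l1norm_nonneg: "0 \<le> l1norm G f"
  unfolding l1norm_def by (intro infsum_nonneg) auto

lemma l1norm_scale: "l1norm G (\<lambda>x. c * f x) = \<bar>c\<bar> * l1norm G f"
  unfolding l1norm_def by (simp add: abs_mult infsum_cmult_right')

lemma l1norm_cong:
  assumes "\<And>x. x \<in> carrier G \<Longrightarrow> f x = f' x"
  shows "l1norm G f = l1norm G f'"
  unfolding l1norm_def using assms by (intro infsum_cong) auto

lemma finsupp_add:
  assumes "finsupp G f" "finsupp G f'"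
  shows "finsupp G (\<lambda>x. f x + f' x)"
  using assms unfolding finsupp_def
  by (rule_tac finite_subset[of _ "{x \<in> carrier G. f x \<noteq> 0} \<union> {x \<in> carrier G. f' x \<noteq> 0}"]) auto

lemma finsupp_scale:
  assumes "finsupp G f"
  shows "finsupp G (\<lambda>x. c * f x)"
  using assms unfolding finsupp_def
  by (rule rev_finite_subset) auto

lemma finsupp_diff:
  assumes "finsupp G f" "finsupp G f'"
  shows "finsupp G (\<lambda>x. f x - f' x)"
  using finsupp_add[OF assms(1) finsupp_scale[OF assms(2), of "-1"]] by simp

lemma l1norm_triangle:
  assumes "finsupp G f" "finsupp G f'"
  shows "l1norm G (\<lambda>x. f x + f' x) \<le> l1norm G f + l1norm G f'"
proof -
  define F where "F = {x \<in> carrier G. f x \<noteq> 0} \<union> {x \<in> carrier G. f' x \<noteq> 0}"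
  have F: "finite F" "F \<subseteq> carrier G" using assms by (auto simp: F_def finsupp_def)
  have "l1norm G (\<lambda>x. f x + f' x) = (\<Sum>x\<in>F. \<bar>f x + f' x\<bar>)"
    using F by (intro l1norm_eq_sum) (auto simp: F_def)
  also have "\<dots> \<le> (\<Sum>x\<in>F. \<bar>f x\<bar>) + (\<Sum>x\<in>F. \<bar>f' x\<bar>)"
    unfolding sum.distrib[symmetric] by (intro sum_mono) (rule abs_triangle_ineq)
  also have "(\<Sum>x\<in>F. \<bar>f x\<bar>) = l1norm G f"
    using F by (intro l1norm_eq_sum[symmetric]) (auto simp: F_def)
  also have "(\<Sum>x\<in>F. \<bar>f' x\<bar>) = l1norm G f'"
    using F by (intro l1norm_eq_sum[symmetric]) (auto simp: F_def)
  finally show ?thesis .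
qed

context group
begin

lemma translate_property_finite_sum:
  assumes tp: "translate_property G f" and J: "finite J" and g: "\<And>j. j \<in> J \<Longrightarrow> g j \<in> carrier G"
    and nonneg: "\<And>x. x \<in> carrier G \<Longrightarrow> 0 \<le> (\<Sum>j\<in>J. t j * translate G (g j) f x)"
  shows "0 \<le> sum t J"
proof -
  obtain b where b: "bij_betw b {1..card J} J"
    using ex_bij_betw_nat_finite_1[OF J] by blast
  have "0 \<le> (\<Sum>i=1..card J. t (b i))"
  proof -
    have "\<forall>i\<in>{1..card J}. g (b i) \<in> carrier G"
      using b g bij_betwE by blast
    moreover have "\<forall>x\<in>carrier G. 0 \<le> (\<Sum>i=1..card J. t (b i) * translate G (g (b i)) f x)"
      using nonneg sum.reindex_bij_betw[OF b, of "\<lambda>j. t j * translate G (g j) f _"] by simp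
    ultimately show ?thesis
      using tp unfolding translate_property_def
      by (elim conjE allE[of _ "card J"] allE[of _ "t \<circ> b"] allE[of _ "g \<circ> b"]) simp
  qed
  then show ?thesis
    using sum.reindex_bij_betw[OF b, of t] by simp
qed

lemma inv_mult_cancel:
  assumes "t \<in> carrier G" "g \<in> carrier G" "x \<in> carrier G"
  shows "inv (t \<otimes> g) \<otimes> x = inv g \<otimes> (inv t \<otimes> x)"
  using assms by (simp add: inv_mult_group m_assoc)

lemma bij_betw_lmult: "a \<in> carrier G \<Longrightarrow> bij_betw (\<lambda>x. a \<otimes> x) (carrier G) (carrier G)"
  by (rule bij_betw_byWitness[of _ "\<lambda>x. inv a \<otimes> x"]) (auto simp: m_assoc[symmetric])

lemma bij_betw_rmult: "a \<in> carrier G \<Longrightarrow> bij_betw (\<lambda>x. x \<otimes> a) (carrier G) (carrier G)"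
  by (rule bij_betw_byWitness[of _ "\<lambda>x. x \<otimes> inv a"]) (auto simp: m_assoc)

lemma finsupp_bij:
  assumes "bij_betw b (carrier G) (carrier G)" "finsupp G f"
  shows "finsupp G (\<lambda>x. f (b x))"
proof -
  have "b ` {x \<in> carrier G. f (b x) \<noteq> 0} \<subseteq> {x \<in> carrier G. f x \<noteq> 0}"
    using assms(1) by (auto simp: bij_betw_def)
  moreover have "inj_on b {x \<in> carrier G. f (b x) \<noteq> 0}"
    using assms(1) by (auto simp: bij_betw_def inj_on_def)
  ultimately show ?thesis
    using assms(2) unfolding finsupp_def by (meson finite_imageD finite_subset)
qed

lemma finsupp_translate: "a \<in> carrier G \<Longrightarrow> finsupp G f \<Longrightarrow> finsupp G (translate G a f)"
  unfolding translate_def using finsupp_bij[OF bij_betw_lmult, of "inv a" f] by simp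

lemma l1norm_translate: "a \<in> carrier G \<Longrightarrow> l1norm G (translate G a f) = l1norm G f"
  unfolding translate_def l1norm_def
  by (rule infsum_reindex_bij_betw[of "\<lambda>x. inv a \<otimes> x" _ _ "\<lambda>x. \<bar>f x\<bar>"]) (rule bij_betw_lmult, simp)

lemma infsum_translate:
  "a \<in> carrier G \<Longrightarrow> infsum (translate G a f) (carrier G) = infsum f (carrier G)"
  unfolding translate_def
  by (rule infsum_reindex_bij_betw) (rule bij_betw_lmult, simp)

lemma l1norm_rmult: "a \<in> carrier G \<Longrightarrow> l1norm G (\<lambda>x. f (x \<otimes> a)) = l1norm G f"
  unfolding l1norm_def
  by (rule infsum_reindex_bij_betw[of "\<lambda>x. x \<otimes> a" _ _ "\<lambda>x. \<bar>f x\<bar>"]) (rule bij_betw_rmult)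

lemma finsupp_combination:
  assumes "snd ` set xs \<subseteq> carrier G" "finsupp G f"
  shows "finsupp G (combination G xs f)"
  using assms
proof (induction xs)
  case Nil
  then show ?case by (simp add: finsupp_def)
next
  case (Cons p xs)
  obtain c a where p: "p = (c, a)" by (cases p)
  have "finsupp G (\<lambda>x. c * translate G a f x + combination G xs f x)"
    using Cons p by (intro finsupp_add finsupp_scale finsupp_translate) auto
  moreover have "combination G (p # xs) f = (\<lambda>x. c * translate G a f x + combination G xs f x)"
    by (simp add: p fun_eq_iff)
  ultimately show ?case by simp
qed

lemma l1norm_combination_le:
  assumes "set xs \<subseteq> {0..} \<times> carrier G" "finsupp G f"
  shows "l1norm G (combination G xs f) \<le> total_weight xs * l1norm G f"
  using assms
proof (induction xs)
  case Nil
  then show ?case by (simp add: l1norm_def)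
next
  case (Cons p xs)
  obtain c a where p: "p = (c, a)" by (cases p)
  have ca: "0 \<le> c" "a \<in> carrier G" "snd ` set xs \<subseteq> carrier G" using Cons.prems p by auto
  have "l1norm G (combination G (p # xs) f) = l1norm G (\<lambda>x. c * translate G a f x + combination G xs f x)"
    by (rule l1norm_cong) (simp add: p)
  also have "\<dots> \<le> l1norm G (\<lambda>x. c * translate G a f x) + l1norm G (combination G xs f)"
    using ca Cons.prems by (intro l1norm_triangle finsupp_scale finsupp_translate finsupp_combination) auto
  also have "\<dots> \<le> c * l1norm G f + total_weight xs * l1norm G f"
    using Cons ca by (intro add_mono) (auto simp: l1norm_scale l1norm_translate)
  finally show ?case by (simp only: p total_weight_simps distrib_right)
qed

lemma infsum_combination:
  assumes "snd ` set xs \<subseteq> carrier G" "finsupp G f"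
  shows "infsum (combination G xs f) (carrier G) = total_weight xs * infsum f (carrier G)"
  using assms
proof (induction xs)
  case Nil
  have "infsum (combination G [] f) (carrier G) = 0"
    by (rule infsum_0) simp
  then show ?case by simp
next
  case (Cons p xs)
  obtain c a where p: "p = (c, a)" by (cases p)
  have summ: "g summable_on carrier G" if "finsupp G g" for g :: "'a \<Rightarrow> real"
    using that unfolding finsupp_def by (rule finite_nonzero_values_imp_summable_on)
  have "infsum (combination G (p # xs) f) (carrier G)
      = (\<Sum>\<^sub>\<infinity>x\<in>carrier G. c * translate G a f x + combination G xs f x)"
    by (rule infsum_cong) (simp add: p)
  also have "\<dots> = (\<Sum>\<^sub>\<infinity>x\<in>carrier G. c * translate G a f x) + infsum (combination G xs f) (carrier G)"
    using Cons.prems p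
    by (intro infsum_add summ finsupp_scale finsupp_translate finsupp_combination) auto
  also have "\<dots> = c * infsum f (carrier G) + total_weight xs * infsum f (carrier G)"
    using Cons p by (simp add: infsum_cmult_right' infsum_translate)
  finally show ?case by (simp only: p total_weight_simps distrib_right)
qed

lemma combination_rmult:
  assumes "snd ` set xs \<subseteq> carrier G" "x \<in> carrier G" "s \<in> carrier G"
  shows "combination G xs f (x \<otimes> s) = combination G xs (\<lambda>x. f (x \<otimes> s)) x"
  using assms(1)
proof (induction xs)
  case (Cons p xs)
  obtain c a where p: "p = (c, a)" by (cases p)
  have "translate G a f (x \<otimes> s) = translate G a (\<lambda>x. f (x \<otimes> s)) x"
    using Cons.prems p assms(2,3) by (simp add: translate_def m_assoc)
  then show ?case using Cons p by simp
qed simp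

lemma combination_nonneg:
  assumes "set xs \<subseteq> {0..} \<times> carrier G" "\<And>x. x \<in> carrier G \<Longrightarrow> 0 \<le> f x" "x \<in> carrier G"
  shows "0 \<le> combination G xs f x"
  using assms(1)
proof (induction xs)
  case (Cons p xs)
  obtain c a where p: "p = (c, a)" by (cases p)
  have "0 \<le> translate G a f x"
    unfolding translate_def using Cons.prems p assms(3) by (intro assms(2)) auto
  then show ?case using Cons p by simp
qed simp

text \<open>
  Separation of \<open>0\<close> from the convex hull of the translates of \<open>u\<close> in \<open>l\<^sup>1\<close>. The separating
  functional is evaluated at point masses to obtain the function \<open>h\<close>. In the cone \<open>D\<close> below,
  \<open>(f, t)\<close> with \<open>t\<close> the norm of \<open>f\<close> forces the functional to have norm at most \<open>1\<close>, and the
  combinations force it to be at least \<open>\<epsilon>\<close> at each translate of \<open>u\<close>.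
\<close>
lemma small_combination_or_bounded_function:
  assumes u: "finsupp G u"
    and large: "\<And>xs. set xs \<subseteq> {0..} \<times> carrier G \<Longrightarrow> total_weight xs = 1 \<Longrightarrow> \<epsilon> \<le> l1norm G (combination G xs u)"
  shows "\<exists>h. (\<forall>x. \<bar>h x\<bar> \<le> 1) \<and>
    (\<forall>a\<in>carrier G. \<epsilon> \<le> (\<Sum>g | g \<in> carrier G \<and> u g \<noteq> 0. u g * h (a \<otimes> g)))"
proof -
  define D where "D = {(f, t). finsupp G f \<and> (\<exists>xs. set xs \<subseteq> {0..} \<times> carrier G \<and>
      l1norm G (\<lambda>x. f x + combination G xs u x) - \<epsilon> * total_weight xs \<le> t)}"
  have weights_nonneg: "0 \<le> total_weight xs" if "set xs \<subseteq> {0..} \<times> carrier G" for xs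
    using that by (induction xs) auto
  have fs_comb: "finsupp G (combination G xs u)" if "set xs \<subseteq> {0..} \<times> carrier G" for xs
    using that u by (intro finsupp_combination) auto
  have norm_D: "(f, l1norm G f) \<in> D" if "finsupp G f" for f
    unfolding D_def using that by (auto intro!: exI[of _ "[]"])
  have "\<exists>L. (\<forall>f f'. finsupp G f \<longrightarrow> finsupp G f' \<longrightarrow> L (\<lambda>x. f x + f' x) = L f + L f') \<and>
      (\<forall>f c. finsupp G f \<longrightarrow> L (\<lambda>x. c * f x) = c * L f) \<and> (\<forall>f t. (f, t) \<in> D \<longrightarrow> L f \<le> (t::real))"
  proof (rule cone_dominated_linear_functional[of "Collect (finsupp G)" D])
    fix f f' and t r assume "(f, t) \<in> D" "(f', r) \<in> D"
    then obtain xs ys where *: "finsupp G f" "finsupp G f'"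
      "set xs \<subseteq> {0..} \<times> carrier G" "l1norm G (\<lambda>x. f x + combination G xs u x) - \<epsilon> * total_weight xs \<le> t"
      "set ys \<subseteq> {0..} \<times> carrier G" "l1norm G (\<lambda>x. f' x + combination G ys u x) - \<epsilon> * total_weight ys \<le> r"
      unfolding D_def by blast
    have "l1norm G (\<lambda>x. (f x + f' x) + combination G (xs @ ys) u x)
        = l1norm G (\<lambda>x. (f x + combination G xs u x) + (f' x + combination G ys u x))"
      by (simp add: algebra_simps)
    also have "\<dots> \<le> l1norm G (\<lambda>x. f x + combination G xs u x) + l1norm G (\<lambda>x. f' x + combination G ys u x)"
      using * fs_comb by (intro l1norm_triangle finsupp_add) auto
    finally have "l1norm G (\<lambda>x. (f x + f' x) + combination G (xs @ ys) u x) - \<epsilon> * total_weight (xs @ ys) \<le> t + r"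
      using * by (simp add: algebra_simps)
    moreover have "set (xs @ ys) \<subseteq> {0..} \<times> carrier G" using * by simp
    ultimately show "(\<lambda>x. f x + f' x, t + r) \<in> D"
      unfolding D_def using *(1,2) finsupp_add by blast
  next
    fix f t and c :: real assume "(f, t) \<in> D" and c: "0 \<le> c"
    then obtain xs where *: "finsupp G f" "set xs \<subseteq> {0..} \<times> carrier G"
      "l1norm G (\<lambda>x. f x + combination G xs u x) - \<epsilon> * total_weight xs \<le> t"
      unfolding D_def by blast
    have "l1norm G (\<lambda>x. c * f x + combination G (rescale c xs) u x)
        = c * l1norm G (\<lambda>x. f x + combination G xs u x)"
      using l1norm_scale[of G c "\<lambda>x. f x + combination G xs u x"] c by (simp add: algebra_simps)
    then have "l1norm G (\<lambda>x. c * f x + combination G (rescale c xs) u x) - \<epsilon> * total_weight (rescale c xs) \<le> c * t"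
      using mult_left_mono[OF *(3) c] by (simp add: algebra_simps)
    moreover have "set (rescale c xs) \<subseteq> {0..} \<times> carrier G"
      using *(2) c by (auto simp: set_rescale)
    ultimately show "(\<lambda>x. c * f x, c * t) \<in> D"
      unfolding D_def using finsupp_scale[OF *(1)] by blast
  next
    fix t assume "(\<lambda>x. 0, t) \<in> D"
    then obtain xs where *: "set xs \<subseteq> {0..} \<times> carrier G" "l1norm G (combination G xs u) - \<epsilon> * total_weight xs \<le> t"
      unfolding D_def by auto
    show "0 \<le> t"
    proof (cases "total_weight xs = 0")
      case True
      then show ?thesis using * l1norm_nonneg[of G "combination G xs u"] by simp
    next
      case False
      define k where "k = 1 / total_weight xs"
      have k: "0 < k" "k * total_weight xs = 1" using False weights_nonneg[OF *(1)] by (auto simp: k_def)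
      have "\<epsilon> \<le> l1norm G (combination G (rescale k xs) u)"
        using *(1) k by (intro large) (auto simp: set_rescale)
      also have "\<dots> = k * l1norm G (combination G xs u)"
        using k l1norm_scale[of G k "combination G xs u"] by (simp add: l1norm_def)
      finally have "total_weight xs * \<epsilon> \<le> total_weight xs * (k * l1norm G (combination G xs u))"
        using weights_nonneg[OF *(1)] by (intro mult_left_mono)
      also have "\<dots> = (k * total_weight xs) * l1norm G (combination G xs u)" by (simp add: mult_ac)
      finally show ?thesis using * k by (simp add: mult.commute)
    qed
  next
    fix L :: "('a \<Rightarrow> real) \<Rightarrow> real"
    assume "\<And>f g. f \<in> Collect (finsupp G) \<Longrightarrow> g \<in> Collect (finsupp G) \<Longrightarrow> L (\<lambda>x. f x + g x) = L f + L g"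
      "\<And>f c. f \<in> Collect (finsupp G) \<Longrightarrow> L (\<lambda>x. c * f x) = c * L f"
      "\<And>f t. (f, t) \<in> D \<Longrightarrow> L f \<le> t"
    then show ?thesis by blast
  qed (auto simp: D_def intro: finsupp_add finsupp_scale intro!: exI[of _ "[]"])
  then obtain L where L_add: "\<And>f f'. finsupp G f \<Longrightarrow> finsupp G f' \<Longrightarrow> L (\<lambda>x. f x + f' x) = L f + L f'"
    and L_scale: "\<And>f c. finsupp G f \<Longrightarrow> L (\<lambda>x. c * f x) = c * L f"
    and L_le: "\<And>f t. (f, t) \<in> D \<Longrightarrow> L f \<le> (t::real)"
    by blast
  have L_norm: "L f \<le> l1norm G f" if "finsupp G f" for f
    using norm_D[OF that] by (rule L_le)
  have L_abs: "\<bar>L f\<bar> \<le> l1norm G f" if "finsupp G f" for f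
    using L_norm[OF that] L_norm[OF finsupp_scale[OF that, of "-1"]] L_scale[OF that, of "-1"]
      l1norm_scale[of G "-1" f] by simp
  have L_cong: "L f = L f'" if "finsupp G f" "finsupp G f'" "\<And>x. x \<in> carrier G \<Longrightarrow> f x = f' x" for f f'
  proof -
    have "L (\<lambda>x. f x + (-1) * f' x) = L f + (-1) * L f'"
      using L_add[OF that(1) finsupp_scale[OF that(2), of "-1"]] L_scale[OF that(2), of "-1"] by simp
    moreover have "l1norm G (\<lambda>x. f x + (-1) * f' x) = l1norm G (\<lambda>x. 0)"
      using that by (intro l1norm_cong) auto
    moreover have "l1norm G (\<lambda>x. 0) = 0" by (simp add: l1norm_def)
    ultimately show ?thesis
      using L_abs[OF finsupp_add[OF that(1) finsupp_scale[OF that(2), of "-1"]]] by simp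
  qed
  have fs_sum: "finsupp G (\<lambda>x. \<Sum>y\<in>F. c y * d y x)" and L_sum: "L (\<lambda>x. \<Sum>y\<in>F. c y * d y x) = (\<Sum>y\<in>F. c y * L (d y))"
    if "finite F" "\<And>y. y \<in> F \<Longrightarrow> finsupp G (d y)" for F and c :: "'a \<Rightarrow> real" and d
  proof -
    have "finsupp G (\<lambda>x. \<Sum>y\<in>F. c y * d y x) \<and> L (\<lambda>x. \<Sum>y\<in>F. c y * d y x) = (\<Sum>y\<in>F. c y * L (d y))"
      using that
    proof (induction F rule: finite_induct)
      case empty
      have "finsupp G (\<lambda>x. 0)" by (simp add: finsupp_def)
      then show ?case using L_scale[of "\<lambda>x. 0" 0] by simp
    next
      case (insert y F)
      then show ?case by (simp add: L_add L_scale finsupp_add finsupp_scale)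
    qed
    then show "finsupp G (\<lambda>x. \<Sum>y\<in>F. c y * d y x)" "L (\<lambda>x. \<Sum>y\<in>F. c y * d y x) = (\<Sum>y\<in>F. c y * L (d y))"
      by auto
  qed
  define \<delta> where "\<delta> x = (\<lambda>y::'a. of_bool (y = x) :: real)" for x
  have fs_\<delta>: "finsupp G (\<delta> x)" for x
    unfolding finsupp_def \<delta>_def by (rule finite_subset[of _ "{x}"]) auto
  define Y where "Y = {g \<in> carrier G. u g \<noteq> 0}"
  have Y: "finite Y" "Y \<subseteq> carrier G" using u by (auto simp: Y_def finsupp_def)
  show ?thesis
  proof (intro exI[of _ "\<lambda>x. L (\<delta> x)"] conjI allI ballI)
    show "\<bar>L (\<delta> x)\<bar> \<le> 1" for x
    proof -
      have "l1norm G (\<delta> x) = (\<Sum>y\<in>carrier G \<inter> {x}. \<bar>\<delta> x y\<bar>)"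
        by (intro l1norm_eq_sum) (auto simp: \<delta>_def)
      also have "\<dots> \<le> (\<Sum>y\<in>{x}. \<bar>\<delta> x y\<bar>)" by (intro sum_mono2) auto
      finally show ?thesis using L_abs[OF fs_\<delta>, of x] by (simp add: \<delta>_def)
    qed
    fix a assume a: "a \<in> carrier G"
    have fs_t: "finsupp G (translate G a u)" using finsupp_translate[OF a u] .
    have "(\<lambda>x. (-1) * translate G a u x, - \<epsilon>) \<in> D"
      unfolding D_def using finsupp_scale[OF fs_t, of "-1"] a
      by (auto intro!: exI[of _ "[(1, a)]"] simp: l1norm_def)
    then have "\<epsilon> \<le> L (translate G a u)"
      using L_le L_scale[OF fs_t, of "-1"] by fastforce
    also have "L (translate G a u) = L (\<lambda>x. \<Sum>g\<in>Y. u g * \<delta> (a \<otimes> g) x)"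
    proof (rule L_cong[OF fs_t])
      show "finsupp G (\<lambda>x. \<Sum>g\<in>Y. u g * \<delta> (a \<otimes> g) x)"
        using fs_sum[OF Y(1), of "\<lambda>g. \<delta> (a \<otimes> g)"] fs_\<delta> by simp
      fix x assume x: "x \<in> carrier G"
      have "(\<Sum>g\<in>Y. u g * \<delta> (a \<otimes> g) x) = (\<Sum>g\<in>Y. if g = inv a \<otimes> x then u g else 0)"
      proof (rule sum.cong[OF refl])
        fix g assume "g \<in> Y"
        then have "x = a \<otimes> g \<longleftrightarrow> g = inv a \<otimes> x"
          using a x Y by (metis inv_solve_left subsetD)
        then show "u g * \<delta> (a \<otimes> g) x = (if g = inv a \<otimes> x then u g else 0)"
          by (simp add: \<delta>_def)
      qed
      also have "\<dots> = u (inv a \<otimes> x)"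
        using Y a x by (auto simp: Y_def)
      finally show "translate G a u x = (\<Sum>g\<in>Y. u g * \<delta> (a \<otimes> g) x)"
        by (simp add: translate_def)
    qed
    also have "\<dots> = (\<Sum>g\<in>Y. u g * L (\<delta> (a \<otimes> g)))"
      using L_sum[OF Y(1), of "\<lambda>g. \<delta> (a \<otimes> g)" u] fs_\<delta> by simp
    finally show "\<epsilon> \<le> (\<Sum>g | g \<in> carrier G \<and> u g \<noteq> 0. u g * L (\<delta> (a \<otimes> g)))"
      by (simp add: Y_def)
  qed
qed

end

section \<open>The translate property for sets implies amenability\<close>

text \<open>
  Reiter's condition for the set \<open>S\<close>. Invariance is required on the right, since it is then
  preserved by combinations of the left translates that occur in the translate property.
\<close>
definition has_almost_invariant_densities :: "('a, 'm) monoid_scheme \<Rightarrow> 'a set \<Rightarrow> bool"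
  where "has_almost_invariant_densities G S \<longleftrightarrow> (\<forall>\<epsilon>>0. \<exists>\<theta>. finsupp G \<theta> \<and>
    (\<forall>x\<in>carrier G. 0 \<le> \<theta> x) \<and> (\<Sum>\<^sub>\<infinity>x\<in>carrier G. \<theta> x) = 1 \<and>
    (\<forall>s\<in>S. l1norm G (\<lambda>x. \<theta> x - \<theta> (x \<otimes>\<^bsub>G\<^esub> s)) \<le> \<epsilon>))"

context group
begin

text \<open>
  The step from functions to sets: a function \<open>h\<close> with values in \<open>[0, 1]\<close> that violates the translate
  property uniformly is replaced by a random set with the same expected values.
\<close>
lemma set_without_translate_property:
  fixes h u :: "'a \<Rightarrow> real"
  assumes inf: "infinite (carrier G)" and Y: "finite Y" "Y \<subseteq> carrier G" and u: "sum u Y = 0"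
    and h: "\<And>x. 0 \<le> h x \<and> h x \<le> 1" and \<delta>: "0 < \<delta>"
    and pos: "\<And>x. x \<in> carrier G \<Longrightarrow> \<delta> \<le> (\<Sum>g\<in>Y. u g * h (inv g \<otimes> x))"
  shows "\<exists>A\<subseteq>carrier G. A \<noteq> {} \<and> \<not> translate_property G (indicator A)"
proof -
  define U where "U = (\<Sum>g\<in>Y. \<bar>u g\<bar>)"
  define \<eta> where "\<eta> = \<delta> / 2"
  have "\<delta> \<le> U"
  proof -
    have "\<delta> \<le> (\<Sum>g\<in>Y. u g * h (inv g \<otimes> \<one>))" using pos by simp
    also have "\<dots> \<le> U"
      unfolding U_def
    proof (rule sum_mono)
      fix g
      have "u g * h (inv g \<otimes> \<one>) \<le> \<bar>u g\<bar> * h (inv g \<otimes> \<one>)"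
        using h by (intro mult_right_mono) auto
      also have "\<dots> \<le> \<bar>u g\<bar> * 1" using h by (intro mult_left_mono) auto
      finally show "u g * h (inv g \<otimes> \<one>) \<le> \<bar>u g\<bar>" by simp
    qed
    finally show ?thesis .
  qed
  then have U: "0 < U" and \<eta>: "0 < \<eta>" "\<eta> \<le> U" "\<delta> = 2 * \<eta>"
    using \<delta> by (auto simp: \<eta>_def)
  then have "Y \<noteq> {}" by (auto simp: U_def)
  then have K: "1 \<le> card Y" using Y by (simp add: Suc_le_eq card_gt_0_iff)
  \<comment> \<open>the rate of the Chernoff bound below\<close>
  define c where "c = \<eta>\<^sup>2 / (4 * U\<^sup>2)"
  have "0 < c" using U \<eta> by (simp add: c_def)
  then have "((\<lambda>n. (real n)\<^sup>2 * exp (- c * real n)) \<longlongrightarrow> 0) sequentially"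
    by real_asymp
  then have "((\<lambda>n. 4 * (real (card Y))\<^sup>2 * ((real n)\<^sup>2 * exp (- c * real n))) \<longlongrightarrow> 0) sequentially"
    by (rule tendsto_mult_right_zero)
  then have "((\<lambda>n. 4 * (real n * real (card Y))\<^sup>2 * exp (- c * real n)) \<longlongrightarrow> 0) sequentially"
    by (simp add: power_mult_distrib mult_ac)
  then have "\<forall>\<^sub>F n in sequentially. 4 * (real n * real (card Y))\<^sup>2 * exp (- c * real n) < 1"
    by (rule order_tendstoD) simp
  then obtain n where n: "1 \<le> n" "4 * (real n * real (card Y))\<^sup>2 * exp (- c * real n) < 1"
    unfolding eventually_sequentially by (meson nle_le order_trans)
  obtain T where T: "T \<subseteq> carrier G" "finite T" "card T = n"
    using infinite_arbitrarily_large[OF inf] by blast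
  \<comment> \<open>Constraint \<open>x\<close> is the inequality at \<open>x\<close> after averaging over the translates by \<open>T\<close>. It involves
    the points of \<open>e x\<close>, where \<open>v\<close> has the coefficient \<open>a x v\<close>.\<close>
  define P where "P = T \<times> Y"
  define \<pi> where "\<pi> x p = inv (fst p \<otimes> snd p) \<otimes> x" for x p
  define e where "e x = \<pi> x ` P" for x
  define a where "a x v = (\<Sum>p\<in>{p \<in> P. \<pi> x p = v}. u (snd p) / n)" for x v
  define N where "N = n * card Y"
  have P: "finite P" "card P = N" "\<And>p. p \<in> P \<Longrightarrow> fst p \<in> carrier G \<and> snd p \<in> carrier G"
    using T Y by (auto simp: P_def N_def card_cartesian_product)
  have \<pi>_inj: "fst p = fst q" if "p \<in> P" "q \<in> P" "x \<in> carrier G" "\<pi> x p = \<pi> x q" "snd p = snd q" for p q x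
  proof -
    have "inv (fst p \<otimes> snd p) = inv (fst q \<otimes> snd q)"
      using that P(3)[OF that(1)] P(3)[OF that(2)] by (simp add: \<pi>_def)
    then have "fst p \<otimes> snd p = fst q \<otimes> snd q"
      using P(3)[OF that(1)] P(3)[OF that(2)] by (metis inv_inv m_closed)
    then show ?thesis
      using that P(3)[OF that(1)] P(3)[OF that(2)] by simp
  qed
  have sum_a: "(\<Sum>v\<in>e x. a x v * F v) = (\<Sum>p\<in>P. u (snd p) / n * F (\<pi> x p))" for x F
    unfolding e_def a_def
    by (subst sum.image_gen[OF P(1), of _ "\<pi> x"]) (auto simp: sum_distrib_right intro!: sum.cong)
  have abs_a: "\<bar>a x v\<bar> \<le> (\<Sum>p\<in>{p \<in> P. \<pi> x p = v}. \<bar>u (snd p)\<bar> / n)" for x v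
    unfolding a_def by (rule order_trans[OF sum_abs]) simp
  \<comment> \<open>for given \<open>g\<close>, at most one \<open>t\<close> satisfies \<open>inv (t \<otimes> g) \<otimes> x = v\<close>\<close>
  have a_le: "\<bar>a x v\<bar> \<le> U / n" if x: "x \<in> carrier G" for x v
  proof -
    have "inj_on snd {p \<in> P. \<pi> x p = v}"
      using \<pi>_inj x by (auto intro!: inj_onI prod_eqI)
    then have "(\<Sum>p\<in>{p \<in> P. \<pi> x p = v}. \<bar>u (snd p)\<bar> / n) = (\<Sum>g\<in>snd ` {p \<in> P. \<pi> x p = v}. \<bar>u g\<bar> / n)"
      by (simp add: sum.reindex)
    also have "\<dots> \<le> (\<Sum>g\<in>Y. \<bar>u g\<bar> / n)"
      using Y by (intro sum_mono2) (auto simp: P_def)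
    finally show ?thesis using abs_a[of x v] by (simp add: U_def sum_divide_distrib)
  qed
  have sum_a_sq: "(\<Sum>v\<in>e x. (a x v)\<^sup>2) \<le> U\<^sup>2 / n" if x: "x \<in> carrier G" for x
  proof -
    have "(\<Sum>v\<in>e x. (a x v)\<^sup>2) \<le> (\<Sum>v\<in>e x. (U / n) * (\<Sum>p\<in>{p \<in> P. \<pi> x p = v}. \<bar>u (snd p)\<bar> / n))"
    proof (rule sum_mono)
      fix v
      have "(a x v)\<^sup>2 = \<bar>a x v\<bar> * \<bar>a x v\<bar>" by (simp add: power2_eq_square)
      also have "\<dots> \<le> (U / n) * (\<Sum>p\<in>{p \<in> P. \<pi> x p = v}. \<bar>u (snd p)\<bar> / n)"
        using a_le[OF x] abs_a U by (intro mult_mono) auto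
      finally show "(a x v)\<^sup>2 \<le> \<dots>" .
    qed
    also have "\<dots> = (U / n) * (\<Sum>p\<in>P. \<bar>u (snd p)\<bar> / n)"
      unfolding e_def by (subst sum.image_gen[OF P(1), of _ "\<pi> x"]) (simp add: sum_distrib_left)
    also have "(\<Sum>p\<in>P. \<bar>u (snd p)\<bar> / n) = U"
      unfolding P_def sum.cartesian_product' using T n
      by (simp add: U_def sum_divide_distrib[symmetric])
    finally show ?thesis by (simp add: power2_eq_square)
  qed
  \<comment> \<open>the minimiser of the exponent \<open>r\<^sup>2 * (U\<^sup>2 / n) - r * \<eta>\<close>\<close>
  define r where "r = \<eta> * n / (2 * U\<^sup>2)"
  have r: "0 \<le> r" using \<eta> U by (simp add: r_def)
  have ra: "\<bar>r * a x v\<bar> \<le> 1" if x: "x \<in> carrier G" for x v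
  proof -
    have "\<bar>r * a x v\<bar> \<le> r * (U / n)"
      unfolding abs_mult using r a_le[OF x] by (intro mult_mono) auto
    also have "\<dots> \<le> 1" using \<eta> U n by (simp add: r_def field_simps power2_eq_square)
    finally show ?thesis .
  qed
  define bad where "bad x B \<longleftrightarrow> (\<Sum>v\<in>e x. a x v * (indicator B v - h v)) < - \<eta>" for x B
  have fin_e: "finite (e x)" for x using P by (simp add: e_def)
  have bad_weight: "(\<Sum>B\<in>{B \<in> Pow (e x). bad x B}. bernoulli_weight h (e x) B) \<le> exp (- c * n)"
    if x: "x \<in> carrier G" for x
  proof -
    have "(\<Sum>B\<in>{B \<in> Pow (e x). bad x B}. bernoulli_weight h (e x) B)
        \<le> exp (r\<^sup>2 * (\<Sum>v\<in>e x. (a x v)\<^sup>2) - r * \<eta>)"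
      unfolding bad_def using fin_e h r ra[OF x] by (rule bernoulli_deviation_le)
    also have "\<dots> \<le> exp (r\<^sup>2 * (U\<^sup>2 / n) - r * \<eta>)"
      using mult_left_mono[OF sum_a_sq[OF x], of "r\<^sup>2"] by simp
    also have "r\<^sup>2 * (U\<^sup>2 / n) - r * \<eta> = - c * n"
      using U n by (simp add: r_def c_def field_simps power2_eq_square)
    finally show ?thesis .
  qed
  have e_sub: "e x \<subseteq> carrier G" if "x \<in> carrier G" for x
    using that P by (auto simp: e_def \<pi>_def)
  have deg: "finite {x \<in> carrier G. v \<in> e x} \<and> card {x \<in> carrier G. v \<in> e x} \<le> N" for v
  proof -
    have "{x \<in> carrier G. v \<in> e x} \<subseteq> (\<lambda>p. (fst p \<otimes> snd p) \<otimes> v) ` P"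
    proof
      fix x assume "x \<in> {x \<in> carrier G. v \<in> e x}"
      then obtain p where p: "x \<in> carrier G" "p \<in> P" "v = inv (fst p \<otimes> snd p) \<otimes> x"
        by (auto simp: e_def \<pi>_def)
      then have "x = (fst p \<otimes> snd p) \<otimes> v"
        using P(3)[OF p(2)] by (simp add: m_assoc[symmetric])
      then show "x \<in> (\<lambda>p. (fst p \<otimes> snd p) \<otimes> v) ` P" using p by blast
    qed
    then have "finite {x \<in> carrier G. v \<in> e x}"
        "card {x \<in> carrier G. v \<in> e x} \<le> card ((\<lambda>p. (fst p \<otimes> snd p) \<otimes> v) ` P)"
      using P(1) by (auto intro: finite_subset card_mono)
    moreover have "card ((\<lambda>p. (fst p \<otimes> snd p) \<otimes> v) ` P) \<le> N"
      using P(1,2) card_image_le[of P] by auto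
    ultimately show ?thesis by linarith
  qed
  have N: "1 \<le> N" using n K by (simp add: N_def)
  have e_prop: "finite (e x) \<and> e x \<noteq> {} \<and> card (e x) \<le> N" for x
  proof -
    have "P \<noteq> {}" using P N by auto
    then show ?thesis using P fin_e card_image_le[OF P(1), of "\<pi> x"] by (auto simp: e_def)
  qed
  have "\<exists>B. \<forall>x\<in>carrier G. \<not> bad x (B \<inter> e x)"
  proof (rule finite_constraints_compactness)
    show "finite (e x)" for x by (rule fin_e)
    fix J assume J: "finite J" "J \<subseteq> carrier G"
    have fin: "finite (\<Union>x\<in>J. e x)" using J fin_e by simp
    have "4 * (real N)\<^sup>2 * exp (- c * n) \<le> 1" using n by (simp add: N_def)
    from rosenfeld_counting[OF h e_prop deg bad_weight this N fin]
    obtain B where "\<And>x. x \<in> carrier G \<Longrightarrow> e x \<subseteq> (\<Union>x\<in>J. e x) \<Longrightarrow> \<not> bad x (B \<inter> e x)"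
      by blast
    then show "\<exists>B. \<forall>x\<in>J. \<not> bad x (B \<inter> e x)" using J by blast
  qed
  then obtain B where B: "\<And>x. x \<in> carrier G \<Longrightarrow> \<not> bad x (B \<inter> e x)" by blast
  define A where "A = B \<inter> carrier G"
  have ge: "\<eta> \<le> (\<Sum>p\<in>P. u (snd p) / n * indicator A (\<pi> x p))" if x: "x \<in> carrier G" for x
  proof -
    have "- \<eta> \<le> (\<Sum>v\<in>e x. a x v * (indicator (B \<inter> e x) v - h v))"
      using B[OF x] by (simp add: bad_def)
    also have "\<dots> = (\<Sum>v\<in>e x. a x v * (indicator A v - h v))"
      using e_sub[OF x] by (intro sum.cong) (auto simp: A_def indicator_def)
    also have "\<dots> = (\<Sum>p\<in>P. u (snd p) / n * indicator A (\<pi> x p)) - (\<Sum>p\<in>P. u (snd p) / n * h (\<pi> x p))"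
      unfolding sum_a by (simp add: right_diff_distrib sum_subtractf)
    finally have "(\<Sum>p\<in>P. u (snd p) / n * h (\<pi> x p)) - \<eta> \<le> (\<Sum>p\<in>P. u (snd p) / n * indicator A (\<pi> x p))"
      by simp
    moreover have "\<delta> \<le> (\<Sum>p\<in>P. u (snd p) / n * h (\<pi> x p))"
    proof -
      have "\<delta> = (\<Sum>t\<in>T. \<delta> / n)" using T n by simp
      also have "\<dots> \<le> (\<Sum>t\<in>T. (\<Sum>g\<in>Y. u g * h (inv g \<otimes> (inv t \<otimes> x))) / n)"
        using T x pos n by (intro sum_mono divide_right_mono) auto
      also have "\<dots> = (\<Sum>t\<in>T. \<Sum>g\<in>Y. u g / n * h (\<pi> x (t, g)))"
        using T Y x by (auto simp: \<pi>_def inv_mult_cancel subset_iff sum_divide_distrib intro!: sum.cong)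
      also have "\<dots> = (\<Sum>p\<in>P. u (snd p) / n * h (\<pi> x p))"
        unfolding P_def sum.cartesian_product' by simp
      finally show ?thesis .
    qed
    ultimately show ?thesis using \<eta> by simp
  qed
  have "A \<noteq> {}" using ge[of \<one>] \<eta> by auto
  moreover have "\<not> translate_property G (indicator A)"
  proof
    assume tp: "translate_property G (indicator A)"
    \<comment> \<open>Since the averaged sum is at least \<open>\<eta>\<close> everywhere, \<open>\<eta> * indicator A\<close> may be subtracted, which
      makes the sum of the coefficients negative.\<close>
    define t where "t j = (case j of None \<Rightarrow> - \<eta> | Some p \<Rightarrow> u (snd p) / n)" for j :: "('a \<times> 'a) option"
    define g where "g j = (case j of None \<Rightarrow> \<one> | Some p \<Rightarrow> fst p \<otimes> snd p)" for j
    have split: "sum F (insert None (Some ` P)) = F None + (\<Sum>p\<in>P. F (Some p))"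
      for F :: "('a \<times> 'a) option \<Rightarrow> real"
      using P by (simp add: sum.reindex)
    have "0 \<le> sum t (insert None (Some ` P))"
    proof (rule translate_property_finite_sum[OF tp])
      show "finite (insert None (Some ` P))" using P by simp
      show "g j \<in> carrier G" if "j \<in> insert None (Some ` P)" for j
        using that P by (auto simp: g_def)
      fix x assume x: "x \<in> carrier G"
      have "\<eta> * indicator A x \<le> \<eta> * 1" using \<eta> by (intro mult_left_mono) (auto simp: indicator_def)
      also have "\<dots> \<le> (\<Sum>p\<in>P. u (snd p) / n * indicator A (\<pi> x p))" using ge[OF x] by simp
      finally show "0 \<le> (\<Sum>j\<in>insert None (Some ` P). t j * translate G (g j) (indicator A) x)"
        unfolding split using x by (simp add: t_def g_def translate_def \<pi>_def)
    qed
    also have "sum t (insert None (Some ` P)) = (\<Sum>p\<in>P. u (snd p) / n) - \<eta>"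
      unfolding split by (simp add: t_def)
    also have "(\<Sum>p\<in>P. u (snd p) / n) = 0"
      unfolding P_def sum.cartesian_product' using u by (simp add: sum_divide_distrib[symmetric])
    finally show False using \<eta> by simp
  qed
  ultimately show ?thesis unfolding A_def by (intro exI[of _ A]) (auto simp: A_def)
qed

text \<open>
  Under the translate property for sets, the alternative provided by the separation theorem is excluded.
  The separating function is composed with the inverse map, as it is evaluated at \<open>a \<otimes> g\<close>, and moved from
  \<open>[- 1, 1]\<close> to \<open>[0, 1]\<close>, which is harmless because the coefficients sum to \<open>0\<close>.
\<close>
lemma small_combination:
  assumes tp: "translate_property_for_sets G" and inf: "infinite (carrier G)"
    and u: "finsupp G u" "(\<Sum>\<^sub>\<infinity>x\<in>carrier G. u x) = 0" and \<epsilon>: "0 < \<epsilon>"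
  shows "\<exists>xs. set xs \<subseteq> {0..} \<times> carrier G \<and> total_weight xs = 1 \<and> l1norm G (combination G xs u) < \<epsilon>"
proof (rule ccontr)
  assume none: "\<not> ?thesis"
  have large: "\<epsilon> \<le> l1norm G (combination G xs u)"
    if "set xs \<subseteq> {0..} \<times> carrier G" "total_weight xs = 1" for xs
    using none that by (meson not_le)
  obtain h where h: "\<And>x. \<bar>h x\<bar> \<le> 1"
    "\<And>a. a \<in> carrier G \<Longrightarrow> \<epsilon> \<le> (\<Sum>g | g \<in> carrier G \<and> u g \<noteq> 0. u g * h (a \<otimes> g))"
    using small_combination_or_bounded_function[OF u(1) large] by blast
  define Y where "Y = {g \<in> carrier G. u g \<noteq> 0}"
  have Y: "finite Y" "Y \<subseteq> carrier G" using u(1) by (auto simp: Y_def finsupp_def)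
  have sum_u: "sum u Y = 0"
    using infsum_finsupp[OF Y, of u] u(2) by (auto simp: Y_def)
  define k where "k x = (h (inv x) + 1) / 2" for x
  have "\<epsilon> / 2 \<le> (\<Sum>g\<in>Y. u g * k (inv g \<otimes> x))" if x: "x \<in> carrier G" for x
  proof -
    have "(\<Sum>g\<in>Y. u g * k (inv g \<otimes> x)) = (\<Sum>g\<in>Y. u g * h (inv x \<otimes> g) / 2 + u g / 2)"
      using Y x by (intro sum.cong) (auto simp: k_def inv_mult_group subset_iff field_simps)
    also have "\<dots> = (\<Sum>g\<in>Y. u g * h (inv x \<otimes> g)) / 2 + sum u Y / 2"
      by (simp add: sum.distrib sum_divide_distrib)
    finally show ?thesis using h(2)[of "inv x"] x sum_u by (simp add: Y_def)
  qed
  moreover have "0 \<le> k x \<and> k x \<le> 1" for x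
    using h(1)[of "inv x"] by (auto simp: k_def)
  ultimately have "\<exists>A\<subseteq>carrier G. A \<noteq> {} \<and> \<not> translate_property G (indicator A)"
    using set_without_translate_property[OF inf Y sum_u, of k "\<epsilon> / 2"] \<epsilon> by simp
  then show False using tp by (auto simp: translate_property_for_sets_def)
qed

text \<open>
  For the uniform density on \<open>1, g, \<dots>, g\<^sup>n\<^sup>-\<^sup>1\<close> the difference telescopes to two point masses of weight
  \<open>1 / n\<close>. The list of powers may contain repetitions when \<open>g\<close> has finite order.
\<close>
lemma almost_invariant_density_cyclic:
  assumes g: "g \<in> carrier G" and \<epsilon>: "0 < \<epsilon>"
  obtains \<theta> where "finsupp G \<theta>" "(\<Sum>\<^sub>\<infinity>x\<in>carrier G. \<theta> x) = 1"
    "l1norm G (\<lambda>x. \<theta> x - \<theta> (x \<otimes> g)) \<le> \<epsilon>"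
proof -
  obtain n where n: "2 / \<epsilon> < real n" using reals_Archimedean2 by blast
  then have n0: "0 < real n" using \<epsilon> by (meson divide_pos_pos less_trans zero_less_numeral)
  define xs where "xs = map (\<lambda>i. (1 / real n, g [^] i)) [0..<n]"
  define \<delta> where "\<delta> x = (of_bool (x = \<one>) :: real)" for x
  define \<theta> where "\<theta> = combination G xs \<delta>"
  have xs: "set xs \<subseteq> {0..} \<times> carrier G" "total_weight xs = 1"
    using g n0 by (auto simp: xs_def total_weight_def o_def sum_list_triv)
  have "{x \<in> carrier G. \<delta> x \<noteq> 0} \<subseteq> {\<one>}" by (auto simp: \<delta>_def)
  then have fs: "finsupp G \<delta>" unfolding finsupp_def by (rule finite_subset) simp
  have val: "translate G a \<delta> x = of_bool (x = a)" if "a \<in> carrier G" "x \<in> carrier G" for a x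
    using that inv_solve_left[of \<one> a x] by (auto simp: translate_def \<delta>_def)
  have \<theta>: "\<theta> x = (\<Sum>i<n. of_bool (x = g [^] i) / real n)" if "x \<in> carrier G" for x
    using that g by (simp add: \<theta>_def combination_def xs_def o_def val sum_list_distinct_conv_sum_set atLeast0LessThan)
  have "\<theta> x - \<theta> (x \<otimes> g) = (of_bool (x \<otimes> g = g [^] n) - of_bool (x \<otimes> g = \<one>)) / real n"
    if x: "x \<in> carrier G" for x
  proof -
    have "x = g [^] i \<longleftrightarrow> x \<otimes> g = g [^] Suc i" for i
      using x g by simp
    then have "\<theta> x - \<theta> (x \<otimes> g) = (\<Sum>i<n. of_bool (x \<otimes> g = g [^] Suc i) / real n - of_bool (x \<otimes> g = g [^] i) / real n)"
      using x g by (simp add: \<theta> sum_subtractf del: nat_pow_Suc)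
    also have "\<dots> = of_bool (x \<otimes> g = g [^] n) / real n - of_bool (x \<otimes> g = g [^] (0::nat)) / real n"
      by (rule sum_lessThan_telescope)
    finally show ?thesis by (simp add: diff_divide_distrib)
  qed
  then have "l1norm G (\<lambda>x. \<theta> x - \<theta> (x \<otimes> g)) =
      l1norm G (\<lambda>x. (1 / real n) * (of_bool (x \<otimes> g = g [^] n) + - 1 * of_bool (x \<otimes> g = \<one>)))"
    by (intro l1norm_cong) simp
  also have "\<dots> = 1 / real n * l1norm G (\<lambda>x. of_bool (x \<otimes> g = g [^] n) + - 1 * of_bool (x \<otimes> g = \<one>))"
    by (subst l1norm_scale) simp
  also have "\<dots> \<le> 1 / real n * (1 + 1)"
  proof -
    have one: "finsupp G (\<lambda>x. c * of_bool (x \<otimes> g = b))" "l1norm G (\<lambda>x. c * of_bool (x \<otimes> g = b)) = \<bar>c\<bar>"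
      if b: "b \<in> carrier G" for b and c :: real
    proof -
      have eq: "x \<otimes> g = b \<longleftrightarrow> x = b \<otimes> inv g" if "x \<in> carrier G" for x
        using that b g by (metis inv_solve_right)
      have "{x \<in> carrier G. c * of_bool (x \<otimes> g = b) \<noteq> 0} \<subseteq> {b \<otimes> inv g}" using g by (auto simp: m_assoc)
      then show "finsupp G (\<lambda>x. c * of_bool (x \<otimes> g = b))"
        unfolding finsupp_def by (rule finite_subset) simp
      show "l1norm G (\<lambda>x. c * of_bool (x \<otimes> g = b)) = \<bar>c\<bar>"
        using b g by (subst l1norm_eq_sum[of "{b \<otimes> inv g}"]) (auto simp: eq m_assoc)
    qed
    have "l1norm G (\<lambda>x. 1 * of_bool (x \<otimes> g = g [^] n) + - 1 * of_bool (x \<otimes> g = \<one>)) \<le> \<bar>1\<bar> + \<bar>- 1\<bar>"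
      using l1norm_triangle[OF one(1)[of "g [^] n" 1] one(1)[of \<one> "- 1"]] one(2)[of "g [^] n" 1] one(2)[of \<one> "- 1"] g
      by simp
    then show ?thesis using n0 by (intro mult_left_mono) auto
  qed
  also have "\<dots> \<le> \<epsilon>" using n n0 \<epsilon> by (simp add: field_simps)
  finally have "l1norm G (\<lambda>x. \<theta> x - \<theta> (x \<otimes> g)) \<le> \<epsilon>" .
  moreover have "finsupp G \<theta>"
    unfolding \<theta>_def using xs fs by (intro finsupp_combination) auto
  moreover have "(\<Sum>\<^sub>\<infinity>x\<in>carrier G. \<theta> x) = 1"
  proof -
    have "infsum \<delta> (carrier G) = sum \<delta> {\<one>}" by (rule infsum_finsupp) (auto simp: \<delta>_def)
    moreover have "snd ` set xs \<subseteq> carrier G" using xs(1) by auto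
    ultimately show ?thesis
      unfolding \<theta>_def using infsum_combination[of xs \<delta>] xs(2) fs by (simp add: \<delta>_def)
  qed
  ultimately show ?thesis by (intro that)
qed

text \<open>
  The same convex combination of translates is applied to \<open>\<alpha>\<close> and \<open>\<beta>\<close>. The results are close to
  each other in \<open>l\<^sup>1\<close>, and they inherit the almost invariance under \<open>S\<close> and under \<open>g\<close>,
  respectively.
\<close>
lemma has_almost_invariant_densities_insert:
  assumes tp: "translate_property_for_sets G" and inf: "infinite (carrier G)"
    and S: "has_almost_invariant_densities G S" "S \<subseteq> carrier G" and g: "g \<in> carrier G"
  shows "has_almost_invariant_densities G (insert g S)"
  unfolding has_almost_invariant_densities_def
proof (intro allI impI)
  fix \<epsilon> :: real assume "0 < \<epsilon>"
  define \<eta> where "\<eta> = \<epsilon> / 3"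
  have \<eta>: "0 < \<eta>" "\<epsilon> = 3 * \<eta>" using \<open>0 < \<epsilon>\<close> by (auto simp: \<eta>_def)
  obtain \<alpha> where \<alpha>: "finsupp G \<alpha>" "\<And>x. x \<in> carrier G \<Longrightarrow> 0 \<le> \<alpha> x" "(\<Sum>\<^sub>\<infinity>x\<in>carrier G. \<alpha> x) = 1"
      "\<And>s. s \<in> S \<Longrightarrow> l1norm G (\<lambda>x. \<alpha> x - \<alpha> (x \<otimes> s)) \<le> \<eta>"
    using S(1) \<eta>(1) unfolding has_almost_invariant_densities_def by blast
  obtain \<beta> where \<beta>: "finsupp G \<beta>" "(\<Sum>\<^sub>\<infinity>x\<in>carrier G. \<beta> x) = 1"
      "l1norm G (\<lambda>x. \<beta> x - \<beta> (x \<otimes> g)) \<le> \<eta>"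
    using almost_invariant_density_cyclic[OF g \<eta>(1)] .
  have summ: "f summable_on carrier G" if "finsupp G f" for f :: "'a \<Rightarrow> real"
    using that unfolding finsupp_def by (rule finite_nonzero_values_imp_summable_on)
  have "(\<Sum>\<^sub>\<infinity>x\<in>carrier G. \<alpha> x - \<beta> x) = 0"
    using infsum_add[OF summ[OF \<alpha>(1)] summ[OF finsupp_scale[OF \<beta>(1), of "- 1"]]] \<alpha>(3) \<beta>(2)
      infsum_cmult_right'[of "- 1" \<beta> "carrier G"] by simp
  then obtain xs where xs: "set xs \<subseteq> {0..} \<times> carrier G" "total_weight xs = 1"
      "l1norm G (combination G xs (\<lambda>x. \<alpha> x - \<beta> x)) < \<eta>"
    using small_combination[OF tp inf finsupp_diff[OF \<alpha>(1) \<beta>(1)] _ \<eta>(1)] by blast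
  define \<theta> where "\<theta> = combination G xs \<alpha>"
  have xs': "snd ` set xs \<subseteq> carrier G" using xs(1) by auto
  have fs: "finsupp G (combination G xs f)" if "finsupp G f" for f
    using xs' that by (rule finsupp_combination)
  have fsr: "finsupp G (\<lambda>x. f (x \<otimes> s))" if "finsupp G f" "s \<in> carrier G" for f s
    using finsupp_bij[OF bij_betw_rmult[OF that(2)] that(1)] .
  have shift: "l1norm G (\<lambda>x. combination G xs f x - combination G xs f (x \<otimes> s))
      \<le> l1norm G (\<lambda>x. f x - f (x \<otimes> s))" if "finsupp G f" "s \<in> carrier G" for f s
  proof -
    have "l1norm G (\<lambda>x. combination G xs f x - combination G xs f (x \<otimes> s))
        = l1norm G (combination G xs (\<lambda>x. f x - f (x \<otimes> s)))"
      using xs' that by (intro l1norm_cong) (simp add: combination_diff combination_rmult)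
    also have "\<dots> \<le> total_weight xs * l1norm G (\<lambda>x. f x - f (x \<otimes> s))"
      using xs(1) that by (intro l1norm_combination_le finsupp_diff fsr[OF that]) auto
    finally show ?thesis using xs(2) by simp
  qed
  have "l1norm G (\<lambda>x. \<theta> x - \<theta> (x \<otimes> s)) \<le> \<epsilon>" if "s \<in> insert g S" for s
  proof (cases "s \<in> S")
    case True
    then have "l1norm G (\<lambda>x. \<theta> x - \<theta> (x \<otimes> s)) \<le> \<eta>"
      unfolding \<theta>_def using shift[OF \<alpha>(1), of s] \<alpha>(4)[of s] S(2) by force
    then show ?thesis using \<eta> by simp
  next
    case False
    then have [simp]: "s = g" using that by simp
    define \<theta>' where "\<theta>' = combination G xs \<beta>"
    define d where "d = (\<lambda>x. \<theta> x - \<theta>' x)"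
    have fd1: "finsupp G d"
      unfolding d_def \<theta>_def \<theta>'_def by (rule finsupp_diff[OF fs[OF \<alpha>(1)] fs[OF \<beta>(1)]])
    have fd2: "finsupp G (\<lambda>x. - 1 * d (x \<otimes> g))"
      by (rule finsupp_scale[OF fsr[OF fd1 g]])
    have fd3: "finsupp G (\<lambda>x. \<theta>' x - \<theta>' (x \<otimes> g))"
      unfolding \<theta>'_def by (rule finsupp_diff[OF fs[OF \<beta>(1)] fsr[OF fs[OF \<beta>(1)] g]])
    have nd: "l1norm G d \<le> \<eta>"
    proof -
      have "d = combination G xs (\<lambda>x. \<alpha> x - \<beta> x)"
        by (simp add: d_def \<theta>_def \<theta>'_def combination_diff fun_eq_iff)
      then show ?thesis using xs(3) by simp
    qed
    have "l1norm G (\<lambda>x. \<theta> x - \<theta> (x \<otimes> s)) = l1norm G (\<lambda>x. (\<theta>' x - \<theta>' (x \<otimes> g)) + (d x + - 1 * d (x \<otimes> g)))"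
      by (simp add: d_def)
    also have "\<dots> \<le> l1norm G (\<lambda>x. \<theta>' x - \<theta>' (x \<otimes> g)) + l1norm G (\<lambda>x. d x + - 1 * d (x \<otimes> g))"
      by (rule l1norm_triangle[OF fd3 finsupp_add[OF fd1 fd2]])
    also have "l1norm G (\<lambda>x. d x + - 1 * d (x \<otimes> g)) \<le> l1norm G d + l1norm G (\<lambda>x. - 1 * d (x \<otimes> g))"
      by (rule l1norm_triangle[OF fd1 fd2])
    also have "l1norm G (\<lambda>x. - 1 * d (x \<otimes> g)) = l1norm G d"
      using l1norm_scale[of G "- 1" "\<lambda>x. d (x \<otimes> g)"] l1norm_rmult[OF g, of d] by simp
    finally show ?thesis
      using shift[OF \<beta>(1) g] \<beta>(3) nd \<eta> by (simp add: \<theta>'_def)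
  qed
  moreover have "finsupp G \<theta>" unfolding \<theta>_def using fs \<alpha>(1) .
  moreover have "\<forall>x\<in>carrier G. 0 \<le> \<theta> x"
    unfolding \<theta>_def using combination_nonneg[OF xs(1)] \<alpha>(2) by blast
  moreover have "(\<Sum>\<^sub>\<infinity>x\<in>carrier G. \<theta> x) = 1"
    unfolding \<theta>_def using infsum_combination[OF xs' \<alpha>(1)] xs(2) \<alpha>(3) by simp
  ultimately show "\<exists>\<theta>. finsupp G \<theta> \<and> (\<forall>x\<in>carrier G. 0 \<le> \<theta> x) \<and> (\<Sum>\<^sub>\<infinity>x\<in>carrier G. \<theta> x) = 1 \<and>
      (\<forall>s\<in>insert g S. l1norm G (\<lambda>x. \<theta> x - \<theta> (x \<otimes> s)) \<le> \<epsilon>)" by blast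
qed

lemma has_almost_invariant_densities_if_finite:
  assumes fin: "finite (carrier G)"
  shows "has_almost_invariant_densities G S"
proof -
  define \<theta> where "\<theta> x = (1 / real (card (carrier G)))" for x :: 'a
  have "carrier G \<noteq> {}" using one_closed by blast
  then have "(\<Sum>\<^sub>\<infinity>x\<in>carrier G. \<theta> x) = 1" using fin by (simp add: \<theta>_def)
  moreover have "finsupp G \<theta>" using fin by (simp add: finsupp_def)
  moreover have "l1norm G (\<lambda>x. \<theta> x - \<theta> (x \<otimes> s)) = 0" for s
    by (simp add: \<theta>_def l1norm_def)
  moreover have "0 \<le> \<theta> x" for x by (simp add: \<theta>_def)
  ultimately show ?thesis
    unfolding has_almost_invariant_densities_def by (intro allI impI exI[of _ \<theta>]) auto
qed

lemma translate_property_for_sets_imp_amenable: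
  assumes tp: "translate_property_for_sets G" and S: "finite S" "S \<subseteq> carrier G"
  shows "has_almost_invariant_densities G S"
proof (cases "finite (carrier G)")
  case True
  then show ?thesis by (rule has_almost_invariant_densities_if_finite)
next
  case False
  from S show ?thesis
  proof (induction S rule: finite_induct)
    case empty
    define \<delta> where "\<delta> x = (of_bool (x = \<one>) :: real)" for x
    have "infsum \<delta> (carrier G) = sum \<delta> {\<one>}" by (rule infsum_finsupp) (auto simp: \<delta>_def)
    moreover have "finsupp G \<delta>"
      unfolding finsupp_def by (rule finite_subset[of _ "{\<one>}"]) (auto simp: \<delta>_def)
    ultimately show ?case
      unfolding has_almost_invariant_densities_def
      by (intro allI impI exI[of _ \<delta>]) (auto simp: \<delta>_def)
  next
    case (insert g S)
    then show ?case
      using has_almost_invariant_densities_insert[OF tp False, of S g] by simp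
  qed
qed

end

section \<open>Invariant measures on the group\<close>

text \<open>
  The weights may be negative. Under the translate property, the infimum of all such \<open>t\<close> is the largest value at
  \<open>f\<close> that a positive functional with value \<open>1\<close> at all translates of \<open>A\<close> can have.
\<close>
definition dominated :: "('a, 'm) monoid_scheme \<Rightarrow> 'a set \<Rightarrow> ('a \<Rightarrow> real) \<Rightarrow> real \<Rightarrow> bool"
  where "dominated G A f t \<longleftrightarrow> (\<exists>xs. snd ` set xs \<subseteq> carrier G \<and> total_weight xs = t \<and>
    (\<forall>x\<in>carrier G. f x \<le> combination G xs (indicator A) x))"

text \<open>Every invariant functional vanishes at these sums of differences.\<close>
definition coboundary :: "('a, 'm) monoid_scheme \<Rightarrow> (('a \<Rightarrow> real) \<times> 'a) list \<Rightarrow> 'a \<Rightarrow> real"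
  where "coboundary G zs x = (\<Sum>(f, s)\<leftarrow>zs. f x - translate G s f x)"

lemma coboundary_simps [simp]:
  "coboundary G [] x = 0"
  "coboundary G ((f, s) # zs) x = f x - translate G s f x + coboundary G zs x"
  "coboundary G (zs @ zs') x = coboundary G zs x + coboundary G zs' x"
  by (simp_all add: coboundary_def)

lemma coboundary_scale:
  "coboundary G (map (\<lambda>(f, s). (\<lambda>x. c * f x, s)) zs) x = c * coboundary G zs x"
  by (induction zs) (auto simp: translate_def algebra_simps)

lemma dominated_mono:
  assumes "dominated G A f t" "\<And>x. x \<in> carrier G \<Longrightarrow> f' x \<le> f x"
  shows "dominated G A f' t"
proof -
  obtain xs where "snd ` set xs \<subseteq> carrier G" "total_weight xs = t"
    "\<forall>x\<in>carrier G. f x \<le> combination G xs (indicator A) x"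
    using assms(1) unfolding dominated_def by blast
  moreover from this have "\<forall>x\<in>carrier G. f' x \<le> combination G xs (indicator A) x"
    by (intro ballI order_trans[OF assms(2)]) simp_all
  ultimately show ?thesis unfolding dominated_def by blast
qed

lemma dominated_add:
  assumes "dominated G A f t" "dominated G A f' t'"
  shows "dominated G A (\<lambda>x. f x + f' x) (t + t')"
proof -
  obtain xs ys where "snd ` set xs \<subseteq> carrier G" "total_weight xs = t" "snd ` set ys \<subseteq> carrier G" "total_weight ys = t'"
    "\<forall>x\<in>carrier G. f x \<le> combination G xs (indicator A) x"
    "\<forall>x\<in>carrier G. f' x \<le> combination G ys (indicator A) x"
    using assms unfolding dominated_def by blast
  then show ?thesis
    unfolding dominated_def by (intro exI[of _ "xs @ ys"]) (auto intro: add_mono)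
qed

lemma dominated_zero: "dominated G A (\<lambda>x. 0) 0"
  unfolding dominated_def by (intro exI[of _ "[]"]) auto

lemma dominated_scale:
  assumes "dominated G A f t" "0 \<le> c"
  shows "dominated G A (\<lambda>x. c * f x) (c * t)"
proof -
  obtain xs where "snd ` set xs \<subseteq> carrier G" "total_weight xs = t"
    "\<forall>x\<in>carrier G. f x \<le> combination G xs (indicator A) x"
    using assms unfolding dominated_def by blast
  then show ?thesis
    unfolding dominated_def
    by (intro exI[of _ "rescale c xs"]) (use assms(2) in \<open>auto simp: set_rescale intro: mult_left_mono\<close>)
qed

lemma dominated_sum:
  assumes "\<And>i. i \<in> I \<Longrightarrow> dominated G A (F i) (t i)"
  shows "dominated G A (\<lambda>x. \<Sum>i\<in>I. F i x) (\<Sum>i\<in>I. t i)"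
  using assms by (induction I rule: infinite_finite_induct) (simp_all add: dominated_zero dominated_add)

context group
begin

lemma dominated_translate:
  assumes f: "dominated G A f t" and g: "g \<in> carrier G"
  shows "dominated G A (translate G g f) t"
proof -
  obtain xs where xs: "snd ` set xs \<subseteq> carrier G" "total_weight xs = t"
    "\<forall>x\<in>carrier G. f x \<le> combination G xs (indicator A) x"
    using f unfolding dominated_def by blast
  define ys where "ys = map (\<lambda>(c, a). (c, g \<otimes> a)) xs"
  have ys: "combination G ys h x = combination G xs h (inv g \<otimes> x)" if "x \<in> carrier G" for x h
    using xs(1) unfolding ys_def
  proof (induction xs)
    case (Cons p xs)
    obtain c a where p: "p = (c, a)" by (cases p)
    have "translate G (g \<otimes> a) h x = translate G a h (inv g \<otimes> x)"
      using Cons.prems p g that inv_mult_cancel[of g a x] by (simp add: translate_def)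
    then show ?case using Cons p by simp
  qed simp
  have "total_weight ys = t"
    unfolding xs(2)[symmetric] by (simp add: ys_def total_weight_def o_def case_prod_beta)
  moreover have "snd ` set ys \<subseteq> carrier G"
    using xs(1) g by (auto simp: ys_def)
  moreover have "\<forall>x\<in>carrier G. translate G g f x \<le> combination G ys (indicator A) x"
    using xs(3) g by (simp add: ys) (simp add: translate_def)
  ultimately show ?thesis unfolding dominated_def by blast
qed

lemma dominated_nonneg:
  assumes tp: "translate_property G (indicator A)" and d: "dominated G A f t"
    and f: "\<And>x. x \<in> carrier G \<Longrightarrow> 0 \<le> f x"
  shows "0 \<le> t"
proof -
  obtain xs where xs: "snd ` set xs \<subseteq> carrier G" "total_weight xs = t"
    "\<forall>x\<in>carrier G. f x \<le> combination G xs (indicator A) x"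
    using d unfolding dominated_def by blast
  have "0 \<le> (\<Sum>i<length xs. fst (xs ! i))"
  proof (rule translate_property_finite_sum[OF tp])
    show "snd (xs ! i) \<in> carrier G" if "i \<in> {..<length xs}" for i
      using xs(1) that by (auto simp: image_subset_iff)
    fix x assume x: "x \<in> carrier G"
    have "0 \<le> combination G xs (indicator A) x" using f[OF x] xs(3) x by force
    then show "0 \<le> (\<Sum>i\<in>{..<length xs}. fst (xs ! i) * translate G (snd (xs ! i)) (indicator A) x)"
      by (simp add: combination_def sum_list_sum_nth case_prod_beta atLeast0LessThan)
  qed simp
  then show ?thesis
    unfolding xs(2)[symmetric] by (simp add: total_weight_def sum_list_sum_nth atLeast0LessThan)
qed

text \<open>
  The domain of the invariant integral: the functions that are bounded by finitely many translates of
  \<open>A\<close>.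
\<close>
definition integrable_functions :: "'a set \<Rightarrow> ('a \<Rightarrow> real) set"
  where "integrable_functions A = {f. \<exists>t. dominated G A (\<lambda>x. \<bar>f x\<bar>) t}"

text \<open>
  Averaging \<open>f - s f\<close> over \<open>\<theta>\<close> produces a combination of translates of \<open>f\<close> whose coefficients are
  the differences of \<open>\<theta>\<close> and its right translate, which are small in total.
\<close>
lemma coboundary_average_small:
  assumes tp: "translate_property G (indicator A)"
    and f: "dominated G A (\<lambda>x. \<bar>f x\<bar>) \<tau>" and s: "s \<in> carrier G"
    and \<theta>: "finsupp G \<theta>" "l1norm G (\<lambda>x. \<theta> x - \<theta> (x \<otimes> inv s)) \<le> \<epsilon>"
  shows "dominated G A (\<lambda>x. - (\<Sum>g | g \<in> carrier G \<and> \<theta> g \<noteq> 0. \<theta> g * translate G g (\<lambda>x. f x - translate G s f x) x)) (\<epsilon> * \<tau>)"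
proof -
  define Y where "Y = {g \<in> carrier G. \<theta> g \<noteq> 0}"
  \<comment> \<open>contains the supports of \<open>\<theta>\<close> and of its right translate\<close>
  define Z where "Z = Y \<union> (\<lambda>g. g \<otimes> s) ` Y"
  define d where "d g = \<theta> g - \<theta> (g \<otimes> inv s)" for g
  have Y: "finite Y" "Y \<subseteq> carrier G" using \<theta>(1) by (auto simp: Y_def finsupp_def)
  then have Z: "finite Z" "Z \<subseteq> carrier G" using s by (auto simp: Z_def)
  have out: "\<theta> (g \<otimes> inv s) = 0" if "g \<in> carrier G - (\<lambda>g. g \<otimes> s) ` Y" for g
  proof (rule ccontr)
    assume "\<theta> (g \<otimes> inv s) \<noteq> 0"
    then have "g \<otimes> inv s \<in> Y" using that s by (simp add: Y_def)
    moreover have "g = g \<otimes> inv s \<otimes> s" using that s by (simp add: m_assoc)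
    ultimately show False using that by blast
  qed
  have \<tau>: "0 \<le> \<tau>" using dominated_nonneg[OF tp f] by simp
  have "(\<Sum>g\<in>Z. \<bar>d g\<bar>) = l1norm G d"
    using Z out by (intro l1norm_eq_sum[symmetric]) (auto simp: Z_def d_def Y_def)
  also have "\<dots> \<le> \<epsilon>" using \<theta>(2) unfolding d_def .
  finally have sum_d: "(\<Sum>g\<in>Z. \<bar>d g\<bar> * \<tau>) \<le> \<epsilon> * \<tau>"
    using \<tau> by (simp add: sum_distrib_right[symmetric] mult_right_mono)
  have eq: "- (\<Sum>g\<in>Y. \<theta> g * translate G g (\<lambda>x. f x - translate G s f x) x) = (\<Sum>g\<in>Z. - d g * f (inv g \<otimes> x))"
    if x: "x \<in> carrier G" for x
  proof -
    have "(\<Sum>g\<in>Y. \<theta> g * translate G g (\<lambda>x. f x - translate G s f x) x)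
        = (\<Sum>g\<in>Y. \<theta> g * f (inv g \<otimes> x)) - (\<Sum>g\<in>Y. \<theta> g * f (inv (g \<otimes> s) \<otimes> x))"
      unfolding sum_subtractf[symmetric] using Y x s
      by (intro sum.cong) (auto simp: translate_def inv_mult_cancel subset_iff right_diff_distrib)
    also have "(\<Sum>g\<in>Y. \<theta> g * f (inv g \<otimes> x)) = (\<Sum>g\<in>Z. \<theta> g * f (inv g \<otimes> x))"
      using Z by (intro sum.mono_neutral_left) (auto simp: Z_def Y_def)
    also have "(\<Sum>g\<in>Y. \<theta> g * f (inv (g \<otimes> s) \<otimes> x)) = (\<Sum>g\<in>(\<lambda>g. g \<otimes> s) ` Y. \<theta> (g \<otimes> inv s) * f (inv g \<otimes> x))"
    proof -
      have "inj_on (\<lambda>g. g \<otimes> s) Y" using Y s by (intro inj_onI) (auto simp: subset_iff)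
      moreover have "\<theta> (g \<otimes> s \<otimes> inv s) = \<theta> g" if "g \<in> Y" for g
        using that Y s by (simp add: m_assoc subset_iff)
      ultimately show ?thesis by (simp add: sum.reindex)
    qed
    also have "\<dots> = (\<Sum>g\<in>Z. \<theta> (g \<otimes> inv s) * f (inv g \<otimes> x))"
      using Z out by (intro sum.mono_neutral_left) (auto simp: Z_def)
    finally show ?thesis
      by (simp add: d_def sum_subtractf[symmetric] sum_negf[symmetric] algebra_simps)
  qed
  have "dominated G A (\<lambda>x. (\<Sum>g\<in>Z. \<bar>d g\<bar> * translate G g (\<lambda>x. \<bar>f x\<bar>) x) + 0) ((\<Sum>g\<in>Z. \<bar>d g\<bar> * \<tau>) + 0)"
    using Z by (intro dominated_add dominated_zero dominated_sum dominated_scale dominated_translate[OF f]) auto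
  moreover have "dominated G A (indicator A) 1"
    unfolding dominated_def by (intro exI[of _ "[(1, \<one>)]"]) (auto simp: translate_def)
  then have "dominated G A (\<lambda>x. (\<epsilon> * \<tau> - (\<Sum>g\<in>Z. \<bar>d g\<bar> * \<tau>)) * indicator A x) ((\<epsilon> * \<tau> - (\<Sum>g\<in>Z. \<bar>d g\<bar> * \<tau>)) * 1)"
    using sum_d by (intro dominated_scale) auto
  \<comment> \<open>the bound is padded by a multiple of \<open>indicator A\<close> to reach the weight \<open>\<epsilon> * \<tau>\<close> exactly\<close>
  ultimately have "dominated G A (\<lambda>x. ((\<Sum>g\<in>Z. \<bar>d g\<bar> * translate G g (\<lambda>x. \<bar>f x\<bar>) x) + 0) +
      (\<epsilon> * \<tau> - (\<Sum>g\<in>Z. \<bar>d g\<bar> * \<tau>)) * indicator A x) (((\<Sum>g\<in>Z. \<bar>d g\<bar> * \<tau>) + 0) + (\<epsilon> * \<tau> - (\<Sum>g\<in>Z. \<bar>d g\<bar> * \<tau>)) * 1)"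
    by (rule dominated_add)
  then have "dominated G A (\<lambda>x. ((\<Sum>g\<in>Z. \<bar>d g\<bar> * translate G g (\<lambda>x. \<bar>f x\<bar>) x) + 0) +
      (\<epsilon> * \<tau> - (\<Sum>g\<in>Z. \<bar>d g\<bar> * \<tau>)) * indicator A x) (\<epsilon> * \<tau>)"
    by simp
  then show ?thesis
  proof (rule dominated_mono)
    fix x assume x: "x \<in> carrier G"
    have "(\<Sum>g\<in>Z. - d g * f (inv g \<otimes> x)) \<le> (\<Sum>g\<in>Z. \<bar>d g\<bar> * translate G g (\<lambda>x. \<bar>f x\<bar>) x)"
      by (intro sum_mono) (simp add: translate_def abs_mult[symmetric] abs_le_D2)
    moreover have "0 \<le> (\<epsilon> * \<tau> - (\<Sum>g\<in>Z. \<bar>d g\<bar> * \<tau>)) * indicator A x"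
      using sum_d by (intro mult_nonneg_nonneg) auto
    ultimately show "- (\<Sum>g | g \<in> carrier G \<and> \<theta> g \<noteq> 0. \<theta> g * translate G g (\<lambda>x. f x - translate G s f x) x) \<le>
      ((\<Sum>g\<in>Z. \<bar>d g\<bar> * translate G g (\<lambda>x. \<bar>f x\<bar>) x) + 0) + (\<epsilon> * \<tau> - (\<Sum>g\<in>Z. \<bar>d g\<bar> * \<tau>)) * indicator A x"
      using eq[OF x] unfolding Y_def by linarith
  qed
qed

text \<open>
  This is where amenability enters: passing to averages over \<open>\<theta>\<close> preserves domination and makes the
  coboundary arbitrarily small, so that the translate property applies.
\<close>
lemma coboundary_dominated_nonneg:
  assumes tp: "translate_property G (indicator A)"
    and am: "\<forall>S. finite S \<and> S \<subseteq> carrier G \<longrightarrow> has_almost_invariant_densities G S"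
    and zs: "set zs \<subseteq> integrable_functions A \<times> carrier G"
    and dom: "dominated G A (coboundary G zs) t"
  shows "0 \<le> t"
proof -
  define S where "S = (\<lambda>p. inv (snd p)) ` set zs"
  have S: "finite S" "S \<subseteq> carrier G" using zs by (auto simp: S_def)
  have "\<forall>p\<in>set zs. \<exists>\<tau>. dominated G A (\<lambda>x. \<bar>fst p x\<bar>) \<tau>"
    using zs by (auto simp: integrable_functions_def)
  then obtain \<tau> where \<tau>: "\<And>p. p \<in> set zs \<Longrightarrow> dominated G A (\<lambda>x. \<bar>fst p x\<bar>) (\<tau> p)"
    by metis
  define M where "M = (\<Sum>p\<leftarrow>zs. \<tau> p)"
  have le: "- t \<le> \<epsilon> * M" if \<epsilon>: "0 < \<epsilon>" for \<epsilon>
  proof -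
    obtain \<theta> where \<theta>: "finsupp G \<theta>" "\<And>x. x \<in> carrier G \<Longrightarrow> 0 \<le> \<theta> x" "(\<Sum>\<^sub>\<infinity>x\<in>carrier G. \<theta> x) = 1"
        "\<And>s. s \<in> S \<Longrightarrow> l1norm G (\<lambda>x. \<theta> x - \<theta> (x \<otimes> s)) \<le> \<epsilon>"
      using am[rule_format, OF conjI, OF S] \<epsilon> unfolding has_almost_invariant_densities_def by blast
    define Y where "Y = {g \<in> carrier G. \<theta> g \<noteq> 0}"
    have Y: "finite Y" "Y \<subseteq> carrier G" using \<theta>(1) by (auto simp: Y_def finsupp_def)
    define av where "av f x = (\<Sum>g\<in>Y. \<theta> g * translate G g f x)" for f x
    have av_add: "av (\<lambda>x. f x + f' x) x = av f x + av f' x" for f f' x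
      by (simp add: av_def translate_def distrib_left sum.distrib)
    have "dominated G A (\<lambda>x. - av (coboundary G zs) x) (\<epsilon> * M)"
      using zs \<tau> \<theta>(4) unfolding M_def S_def
    proof (induction zs)
      case Nil
      have zero: "(\<lambda>x. - av (coboundary G []) x) = (\<lambda>x. 0)" by (simp add: av_def translate_def)
      show ?case unfolding zero by (simp add: dominated_zero)
    next
      case (Cons p zs)
      obtain f s where p: "p = (f, s)" by (cases p)
      have "dominated G A (\<lambda>x. - av (\<lambda>x. f x - translate G s f x) x) (\<epsilon> * \<tau> p)"
        unfolding av_def Y_def
        using Cons.prems p \<theta>(1) by (intro coboundary_average_small[OF tp]) auto
      moreover have "dominated G A (\<lambda>x. - av (coboundary G zs) x) (\<epsilon> * (\<Sum>p\<leftarrow>zs. \<tau> p))"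
        using Cons by simp
      ultimately have "dominated G A (\<lambda>x. - av (\<lambda>x. f x - translate G s f x) x + - av (coboundary G zs) x)
          (\<epsilon> * \<tau> p + \<epsilon> * (\<Sum>p\<leftarrow>zs. \<tau> p))"
        by (rule dominated_add)
      moreover have "coboundary G (p # zs) = (\<lambda>x. (f x - translate G s f x) + coboundary G zs x)"
        by (simp add: p fun_eq_iff)
      ultimately show ?case
        using av_add[of "\<lambda>x. f x - translate G s f x" "coboundary G zs"] by (simp add: distrib_left)
    qed
    moreover have "dominated G A (av (coboundary G zs)) t"
    proof -
      have "dominated G A (\<lambda>x. \<Sum>g\<in>Y. \<theta> g * translate G g (coboundary G zs) x) (\<Sum>g\<in>Y. \<theta> g * t)"
        using Y \<theta>(2) by (intro dominated_sum dominated_scale dominated_translate[OF dom]) auto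
      moreover have "(\<Sum>g\<in>Y. \<theta> g * t) = t"
        using infsum_finsupp[OF Y, of \<theta>] \<theta>(3) by (simp add: sum_distrib_right[symmetric] Y_def)
      ultimately show ?thesis unfolding av_def by metis
    qed
    ultimately have "dominated G A (\<lambda>x. - av (coboundary G zs) x + av (coboundary G zs) x) (\<epsilon> * M + t)"
      by (rule dominated_add)
    then have "0 \<le> \<epsilon> * M + t" by (rule dominated_nonneg[OF tp]) simp
    then show ?thesis by simp
  qed
  show ?thesis
  proof (rule ccontr)
    assume "\<not> 0 \<le> t"
    then have t: "t < 0" by simp
    have "- t \<le> (- t / (2 * (\<bar>M\<bar> + 1))) * M" using t by (intro le divide_pos_pos) auto
    also have "\<dots> \<le> (- t / (2 * (\<bar>M\<bar> + 1))) * (\<bar>M\<bar> + 1)"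
      using t by (intro mult_left_mono divide_nonneg_nonneg) auto
    also have "\<dots> = - t / 2" by (simp add: field_simps)
    finally show False using t by simp
  qed
qed

lemma integrable_functions_add:
  assumes "f \<in> integrable_functions A" "f' \<in> integrable_functions A"
  shows "(\<lambda>x. f x + f' x) \<in> integrable_functions A"
proof -
  obtain t t' where "dominated G A (\<lambda>x. \<bar>f x\<bar>) t" "dominated G A (\<lambda>x. \<bar>f' x\<bar>) t'"
    using assms by (auto simp: integrable_functions_def)
  then have "dominated G A (\<lambda>x. \<bar>f x + f' x\<bar>) (t + t')"
    by (rule dominated_mono[OF dominated_add]) (rule abs_triangle_ineq)
  then show ?thesis unfolding integrable_functions_def by blast
qed

lemma integrable_functions_scale:
  assumes "f \<in> integrable_functions A"
  shows "(\<lambda>x. c * f x) \<in> integrable_functions A"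
proof -
  obtain t where "dominated G A (\<lambda>x. \<bar>f x\<bar>) t"
    using assms by (auto simp: integrable_functions_def)
  then have "dominated G A (\<lambda>x. \<bar>c * f x\<bar>) (\<bar>c\<bar> * t)"
    unfolding abs_mult by (rule dominated_scale) simp
  then show ?thesis unfolding integrable_functions_def by blast
qed

lemma integrable_functions_translate:
  assumes "f \<in> integrable_functions A" "g \<in> carrier G"
  shows "translate G g f \<in> integrable_functions A"
proof -
  obtain t where "dominated G A (\<lambda>x. \<bar>f x\<bar>) t"
    using assms by (auto simp: integrable_functions_def)
  then have "dominated G A (\<lambda>x. \<bar>translate G g f x\<bar>) t"
    using dominated_translate[OF _ assms(2)] by (simp add: translate_def)
  then show ?thesis unfolding integrable_functions_def by blast
qed

lemma integrable_functions_mono: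
  assumes "f \<in> integrable_functions A" "\<And>x. x \<in> carrier G \<Longrightarrow> \<bar>f' x\<bar> \<le> \<bar>f x\<bar>"
  shows "f' \<in> integrable_functions A"
proof -
  obtain t where "dominated G A (\<lambda>x. \<bar>f x\<bar>) t"
    using assms(1) by (auto simp: integrable_functions_def)
  then have "dominated G A (\<lambda>x. \<bar>f' x\<bar>) t"
    using assms(2) by (rule dominated_mono)
  then show ?thesis unfolding integrable_functions_def by blast
qed

text \<open>
  The Hahn--Banach theorem is applied to the bounds by combinations of translates of \<open>1\<^sub>A\<close>, taken modulo
  coboundaries. Since a coboundary and its negative thereby get the bound \<open>0\<close>, the functional is invariant.
\<close>
lemma invariant_integral:
  assumes tp: "translate_property G (indicator A)"
    and am: "\<forall>S. finite S \<and> S \<subseteq> carrier G \<longrightarrow> has_almost_invariant_densities G S"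
  shows "\<exists>L :: ('a \<Rightarrow> real) \<Rightarrow> real.
    (\<forall>f\<in>integrable_functions A. \<forall>f'\<in>integrable_functions A. L (\<lambda>x. f x + f' x) = L f + L f') \<and>
    (\<forall>f\<in>integrable_functions A. (\<forall>x\<in>carrier G. 0 \<le> f x) \<longrightarrow> 0 \<le> L f) \<and>
    (\<forall>f\<in>integrable_functions A. \<forall>f'. (\<forall>x\<in>carrier G. f x = f' x) \<longrightarrow> L f = L f') \<and>
    (\<forall>f\<in>integrable_functions A. \<forall>g\<in>carrier G. L (translate G g f) = L f) \<and>
    L (indicator A) = 1"
proof -
  define E where "E = integrable_functions A"
  define D where "D = {(f, t). f \<in> E \<and> (\<exists>zs. set zs \<subseteq> E \<times> carrier G \<and>
      dominated G A (\<lambda>x. f x + coboundary G zs x) t)}"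
  have DI: "(f, t) \<in> D" if "f \<in> E" "set zs \<subseteq> E \<times> carrier G" "dominated G A (\<lambda>x. f x + coboundary G zs x) t" for f t zs
    using that unfolding D_def by blast
  have dom_D: "(f, t) \<in> D" if "f \<in> E" "dominated G A f t" for f t
    using that by (intro DI[of _ "[]"]) auto
  obtain L where L_add: "\<And>f f'. f \<in> E \<Longrightarrow> f' \<in> E \<Longrightarrow> L (\<lambda>x. f x + f' x) = L f + L f'"
    and L_scale: "\<And>f c. f \<in> E \<Longrightarrow> L (\<lambda>x. c * f x) = c * L f"
    and L_le: "\<And>f t. (f, t) \<in> D \<Longrightarrow> L f \<le> (t::real)"
  proof (rule cone_dominated_linear_functional[of E D])
    fix f f' t t' assume "(f, t) \<in> D" "(f', t') \<in> D"
    then obtain zs zs' where *: "f \<in> E" "f' \<in> E"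
        "set zs \<subseteq> E \<times> carrier G" "dominated G A (\<lambda>x. f x + coboundary G zs x) t"
        "set zs' \<subseteq> E \<times> carrier G" "dominated G A (\<lambda>x. f' x + coboundary G zs' x) t'"
      unfolding D_def by blast
    have "dominated G A (\<lambda>x. (f x + f' x) + coboundary G (zs @ zs') x) (t + t')"
      using dominated_add[OF *(4,6)] by (simp add: algebra_simps)
    then show "(\<lambda>x. f x + f' x, t + t') \<in> D"
      using * by (intro DI[of _ "zs @ zs'"]) (auto simp: E_def integrable_functions_add)
  next
    fix f t and c :: real assume "(f, t) \<in> D" and c: "0 \<le> c"
    then obtain zs where *: "f \<in> E" "set zs \<subseteq> E \<times> carrier G" "dominated G A (\<lambda>x. f x + coboundary G zs x) t"
      unfolding D_def by blast
    have "dominated G A (\<lambda>x. c * f x + coboundary G (map (\<lambda>(f, s). (\<lambda>x. c * f x, s)) zs) x) (c * t)"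
      using dominated_scale[OF *(3) c] by (simp add: coboundary_scale distrib_left)
    then show "(\<lambda>x. c * f x, c * t) \<in> D"
      using * by (intro DI[of _ "map (\<lambda>(f, s). (\<lambda>x. c * f x, s)) zs"])
        (auto simp: E_def integrable_functions_scale)
  next
    fix f assume f: "f \<in> E"
    then obtain t where "dominated G A (\<lambda>x. \<bar>f x\<bar>) t"
      by (auto simp: E_def integrable_functions_def)
    then have "dominated G A f t" by (rule dominated_mono) simp
    then show "\<exists>t. (f, t) \<in> D" using dom_D f by blast
  next
    fix t assume "(\<lambda>x. 0, t) \<in> D"
    then obtain zs where "set zs \<subseteq> E \<times> carrier G" "dominated G A (coboundary G zs) t"
      unfolding D_def by auto
    then show "0 \<le> t" using coboundary_dominated_nonneg[OF tp am] unfolding E_def by blast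
  qed (auto simp: D_def E_def integrable_functions_add integrable_functions_scale)
  have L_neg: "L (\<lambda>x. - f x) = - L f" if "f \<in> E" for f
    using L_scale[OF that, of "- 1"] by simp
  have E_neg: "(\<lambda>x. - f x) \<in> E" if "f \<in> E" for f
    using integrable_functions_scale[of f A "- 1"] that by (simp add: E_def)
  have pos: "0 \<le> L f" if f: "f \<in> E" "\<And>x. x \<in> carrier G \<Longrightarrow> 0 \<le> f x" for f
  proof -
    have "dominated G A (\<lambda>x. - f x) 0"
      by (rule dominated_mono[OF dominated_zero]) (use f in auto)
    then have "L (\<lambda>x. - f x) \<le> 0" by (rule L_le[OF dom_D[OF E_neg[OF f(1)]]])
    then show ?thesis using L_neg[OF f(1)] by simp
  qed
  have cong: "L f = L f'" if f: "f \<in> E" "\<And>x. x \<in> carrier G \<Longrightarrow> f x = f' x" for f f'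
  proof -
    have f': "f' \<in> E" using integrable_functions_mono[of f A f'] f by (simp add: E_def)
    have "(\<lambda>x. f x + - f' x) \<in> E" "(\<lambda>x. f' x + - f x) \<in> E"
      using f(1) f' E_neg unfolding E_def by (rule_tac integrable_functions_add; blast)+
    then have "0 \<le> L (\<lambda>x. f x + - f' x)" "0 \<le> L (\<lambda>x. f' x + - f x)"
      using f(2) by (simp_all add: pos)
    then show ?thesis
      unfolding L_add[OF f(1) E_neg[OF f']] L_add[OF f' E_neg[OF f(1)]] L_neg[OF f'] L_neg[OF f(1)] by simp
  qed
  have inv_le: "L (translate G g f) \<le> L f" if f: "f \<in> E" "g \<in> carrier G" for f g
  proof -
    have tr: "translate G g f \<in> E" using integrable_functions_translate f by (simp add: E_def)
    have "(\<lambda>x. translate G g f x + - f x, 0) \<in> D"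
      using f tr E_neg[OF f(1)] integrable_functions_add[of "translate G g f" A "\<lambda>x. - f x"] dominated_zero[of G A]
      by (intro DI[of _ "[(f, g)]"]) (auto simp: E_def)
    then have "L (\<lambda>x. translate G g f x + - f x) \<le> 0" by (rule L_le)
    then show ?thesis
      unfolding L_add[OF tr E_neg[OF f(1)]] L_neg[OF f(1)] by simp
  qed
  have inv: "L (translate G g f) = L f" if f: "f \<in> E" "g \<in> carrier G" for f g
  proof (rule antisym)
    have tr: "translate G g f \<in> E" using integrable_functions_translate f by (simp add: E_def)
    have "translate G g (\<lambda>x. - f x) = (\<lambda>x. - translate G g f x)" by (simp add: translate_def)
    then show "L f \<le> L (translate G g f)"
      using inv_le[OF E_neg[OF f(1)] f(2)] L_neg[OF f(1)] L_neg[OF tr] by simp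
  qed (rule inv_le[OF f])
  have dom_A: "dominated G A (indicator A) 1" "dominated G A (\<lambda>x. - indicator A x) (- 1)"
    unfolding dominated_def
    by (intro exI[of _ "[(1, \<one>)]"], auto simp: translate_def)
      (intro exI[of _ "[(- 1, \<one>)]"], auto simp: translate_def)
  have A: "indicator A \<in> E"
    using dom_A(1) unfolding E_def integrable_functions_def by (auto intro!: exI[of _ 1])
  have one: "L (indicator A) = 1"
    using L_le[OF dom_D[OF A dom_A(1)]] L_le[OF dom_D[OF E_neg[OF A] dom_A(2)]] L_neg[OF A] by simp
  show ?thesis
    unfolding E_def[symmetric]
  proof (intro exI[of _ L] conjI ballI allI impI)
    show "L (\<lambda>x. f x + f' x) = L f + L f'" if "f \<in> E" "f' \<in> E" for f f' by (rule L_add[OF that])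
    show "0 \<le> L f" if "f \<in> E" "\<forall>x\<in>carrier G. 0 \<le> f x" for f by (rule pos) (use that in auto)
    show "L f = L f'" if "f \<in> E" "\<forall>x\<in>carrier G. f x = f' x" for f f' by (rule cong) (use that in auto)
    show "L (translate G g f) = L f" if "f \<in> E" "g \<in> carrier G" for f g by (rule inv[OF that])
    show "L (indicator A) = 1" by (rule one)
  qed
qed

text \<open>
  Sets whose indicator function is not integrable get measure \<open>\<infinity>\<close>. This is compatible with additivity
  because subsets of sets with integrable indicator function again have this property.
\<close>
lemma invariant_measure_if_translate_property:
  assumes tp: "translate_property G (indicator A)"
    and am: "\<forall>S. finite S \<and> S \<subseteq> carrier G \<longrightarrow> has_almost_invariant_densities G S"
  shows "\<exists>\<mu>. invariant_fin_add_measure G (carrier G) (\<lambda>g x. g \<otimes> x) \<mu> \<and> \<mu> A = 1"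
proof -
  obtain L :: "('a \<Rightarrow> real) \<Rightarrow> real" where L:
    "\<forall>f\<in>integrable_functions A. \<forall>f'\<in>integrable_functions A. L (\<lambda>x. f x + f' x) = L f + L f'"
    "\<forall>f\<in>integrable_functions A. (\<forall>x\<in>carrier G. 0 \<le> f x) \<longrightarrow> 0 \<le> L f"
    "\<forall>f\<in>integrable_functions A. \<forall>f'. (\<forall>x\<in>carrier G. f x = f' x) \<longrightarrow> L f = L f'"
    "\<forall>f\<in>integrable_functions A. \<forall>g\<in>carrier G. L (translate G g f) = L f"
    "L (indicator A) = 1"
    using invariant_integral[OF tp am] by (elim exE conjE)
  define fin where "fin B \<longleftrightarrow> indicator B \<in> integrable_functions A" for B
  define \<mu> where "\<mu> B = (if fin B then ennreal (L (indicator B)) else \<infinity>)" for B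
  have fin_sub: "fin B" if "fin C" "B \<subseteq> C" for B C
    using that unfolding fin_def
    by (elim integrable_functions_mono) (auto simp: indicator_def)
  have L_pos: "0 \<le> L (indicator B)" if "fin B" for B
    using that L(2) by (simp add: fin_def)
  have "dominated G A (\<lambda>x. \<bar>indicator {} x\<bar>) 0" using dominated_zero by simp
  then have "fin {}" unfolding fin_def integrable_functions_def by blast
  then have "L (\<lambda>x. indicator {} x + indicator {} x) = L (indicator {}) + L (indicator {})"
    using L(1) unfolding fin_def by blast
  moreover have "(indicator {} :: 'a \<Rightarrow> real) = (\<lambda>x. 0)" by (simp add: fun_eq_iff)
  ultimately have "L (indicator {}) = 0" by simp
  then have "\<mu> {} = 0" using \<open>fin {}\<close> by (simp add: \<mu>_def)
  moreover have "additive (Pow (carrier G)) \<mu>"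
    unfolding additive_def
  proof (intro ballI impI)
    fix B C assume disj: "(B :: 'a set) \<inter> C = {}"
    show "\<mu> (B \<union> C) = \<mu> B + \<mu> C"
    proof (cases "fin B \<and> fin C")
      case True
      have ind: "(indicator (B \<union> C) :: 'a \<Rightarrow> real) = (\<lambda>x. indicator B x + indicator C x)"
        using disj by (auto simp: indicator_def fun_eq_iff)
      then have "fin (B \<union> C)" "L (indicator (B \<union> C)) = L (indicator B) + L (indicator C)"
        using True L(1) integrable_functions_add unfolding fin_def by auto
      then show ?thesis using True L_pos by (simp add: \<mu>_def ennreal_plus)
    next
      case False
      then have "\<not> fin (B \<union> C)" using fin_sub by blast
      then show ?thesis using False by (auto simp: \<mu>_def)
    qed
  qed
  moreover have "\<mu> ((\<lambda>x. g \<otimes> x) ` B) = \<mu> B" if g: "g \<in> carrier G" and B: "B \<subseteq> carrier G" for g B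
  proof -
    have ind: "indicator ((\<lambda>x. g \<otimes> x) ` B) x = (translate G g (indicator B) x :: real)" if "x \<in> carrier G" for x
    proof -
      have "x \<in> (\<lambda>x. g \<otimes> x) ` B \<longleftrightarrow> inv g \<otimes> x \<in> B"
      proof
        assume "x \<in> (\<lambda>z. g \<otimes> z) ` B"
        then obtain z where "z \<in> B" "x = g \<otimes> z" by blast
        then show "inv g \<otimes> x \<in> B" using B g by (auto simp: m_assoc[symmetric] subset_iff)
      next
        assume "inv g \<otimes> x \<in> B"
        moreover have "x = g \<otimes> (inv g \<otimes> x)" using g that by (simp add: m_assoc[symmetric])
        ultimately show "x \<in> (\<lambda>z. g \<otimes> z) ` B" by blast
      qed
      then show ?thesis by (simp add: translate_def indicator_def)
    qed
    have ind': "indicator B x = (translate G (inv g) (indicator ((\<lambda>x. g \<otimes> x) ` B)) x :: real)" if "x \<in> carrier G" for x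
      using that g ind[of "g \<otimes> x"] by (simp add: translate_def m_assoc[symmetric])
    have eq: "fin ((\<lambda>x. g \<otimes> x) ` B) \<longleftrightarrow> fin B"
    proof
      assume "fin ((\<lambda>x. g \<otimes> x) ` B)"
      then have "translate G (inv g) (indicator ((\<lambda>x. g \<otimes> x) ` B)) \<in> integrable_functions A"
        using g integrable_functions_translate by (simp add: fin_def)
      then show "fin B" unfolding fin_def by (rule integrable_functions_mono) (simp add: ind')
    next
      assume "fin B"
      then have "translate G g (indicator B) \<in> integrable_functions A"
        using g integrable_functions_translate by (simp add: fin_def)
      then show "fin ((\<lambda>x. g \<otimes> x) ` B)" unfolding fin_def by (rule integrable_functions_mono) (simp add: ind)
    qed
    show ?thesis
    proof (cases "fin B")
      case True
      then have "L (indicator ((\<lambda>x. g \<otimes> x) ` B)) = L (translate G g (indicator B))"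
        using eq ind by (intro L(3)[rule_format]) (auto simp: fin_def)
      also have "\<dots> = L (indicator B)" using True g by (intro L(4)[rule_format]) (auto simp: fin_def)
      finally show ?thesis using True eq by (simp add: \<mu>_def)
    qed (use eq in \<open>simp add: \<mu>_def\<close>)
  qed
  moreover have "\<mu> A = 1"
  proof -
    have "dominated G A (\<lambda>x. \<bar>indicator A x\<bar>) 1"
      unfolding dominated_def by (intro exI[of _ "[(1, \<one>)]"]) (auto simp: translate_def)
    then have "fin A" unfolding fin_def integrable_functions_def by blast
    then show ?thesis using L(5) by (simp add: \<mu>_def)
  qed
  ultimately show ?thesis
    by (intro exI[of _ \<mu>]) (auto simp: invariant_fin_add_measure_def positive_def)
qed

end

section \<open>Invariant measures on sets with a group action\<close>

text \<open>
  The integral of the combination, without integration theory: the sets \<open>B j\<close> cut \<open>X\<close> into finitely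
  many cells on which the combination is constant. Cells outside all \<open>B j\<close> may have infinite measure, but
  there the combination vanishes, and \<open>enn2real\<close> maps this measure to \<open>0\<close>.
\<close>
lemma fin_add_measure_combination_nonneg:
  fixes \<mu> :: "'x set \<Rightarrow> ennreal" and B :: "'j \<Rightarrow> 'x set" and t :: "'j \<Rightarrow> real"
  assumes pos: "positive (Pow X) \<mu>" and add: "additive (Pow X) \<mu>" and J: "finite J"
    and B: "\<And>j. j \<in> J \<Longrightarrow> B j \<subseteq> X \<and> \<mu> (B j) = 1"
    and nonneg: "\<And>x. x \<in> X \<Longrightarrow> 0 \<le> (\<Sum>j\<in>J. t j * indicator (B j) x)"
  shows "0 \<le> sum t J"
proof -
  define cell where "cell S = {x \<in> X. {j \<in> J. x \<in> B j} = S}" for S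
  have un: "\<mu> (\<Union>S\<in>\<S>. cell S) = (\<Sum>S\<in>\<S>. \<mu> (cell S))" if "finite \<S>" for \<S>
    using that
  proof (induction \<S> rule: finite_induct)
    case empty
    then show ?case using pos by (simp add: positive_def)
  next
    case (insert S \<S>)
    have "cell S \<inter> (\<Union>S\<in>\<S>. cell S) = {}" using insert by (auto simp: cell_def)
    moreover have "cell S \<in> Pow X" "(\<Union>S\<in>\<S>. cell S) \<in> Pow X" by (auto simp: cell_def)
    ultimately have "\<mu> (cell S \<union> (\<Union>S\<in>\<S>. cell S)) = \<mu> (cell S) + \<mu> (\<Union>S\<in>\<S>. cell S)"
      using add unfolding additive_def by blast
    then show ?case using insert by simp
  qed
  have B_un: "(\<Sum>S\<in>{S \<in> Pow J. j \<in> S}. \<mu> (cell S)) = 1" if j: "j \<in> J" for j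
  proof -
    have "(\<Union>S\<in>{S \<in> Pow J. j \<in> S}. cell S) = B j"
    proof (intro Set.set_eqI iffI)
      fix x assume "x \<in> B j"
      then show "x \<in> (\<Union>S\<in>{S \<in> Pow J. j \<in> S}. cell S)"
        using B[OF j] j by (intro UN_I[of "{j \<in> J. x \<in> B j}"]) (auto simp: cell_def)
    qed (auto simp: cell_def)
    moreover have "finite {S \<in> Pow J. j \<in> S}" using J by simp
    ultimately show ?thesis using B[OF j] un[of "{S \<in> Pow J. j \<in> S}"] by metis
  qed
  define m where "m S = enn2real (\<mu> (cell S))" for S
  have fin: "\<mu> (cell S) < \<infinity>" if "S \<in> Pow J" "S \<noteq> {}" for S
  proof -
    obtain j where j: "j \<in> S" "j \<in> J" using \<open>S \<in> Pow J\<close> \<open>S \<noteq> {}\<close> by blast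
    then have "\<mu> (cell S) \<le> (\<Sum>S\<in>{S \<in> Pow J. j \<in> S}. \<mu> (cell S))"
      using that J by (intro member_le_sum) auto
    also have "\<dots> = 1" by (rule B_un[OF j(2)])
    finally show ?thesis using ennreal_one_less_top by (simp add: le_less_trans)
  qed
  have m_sum: "(\<Sum>S\<in>Pow J. of_bool (j \<in> S) * m S) = 1" if j: "j \<in> J" for j
  proof -
    have "(\<Sum>S\<in>Pow J. of_bool (j \<in> S) * m S) = (\<Sum>S\<in>{S \<in> Pow J. j \<in> S}. m S)"
      using J by (intro sum.mono_neutral_cong_right) auto
    also have "\<dots> = enn2real (\<Sum>S\<in>{S \<in> Pow J. j \<in> S}. \<mu> (cell S))"
      unfolding m_def using fin by (subst enn2real_sum) auto
    finally show ?thesis using B_un[OF j] by simp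
  qed
  have "0 \<le> (\<Sum>S\<in>Pow J. m S * sum t S)"
  proof (rule sum_nonneg)
    fix S assume S: "S \<in> Pow J"
    show "0 \<le> m S * sum t S"
    proof (cases "cell S = {}")
      case True
      then show ?thesis using pos by (simp add: m_def positive_def)
    next
      case False
      then obtain x where x: "x \<in> X" "{j \<in> J. x \<in> B j} = S" by (auto simp: cell_def)
      have "(\<Sum>j\<in>J. t j * indicator (B j) x) = sum t S"
        unfolding x(2)[symmetric] using J by (intro sum.mono_neutral_cong_right) auto
      then show ?thesis using nonneg[OF x(1)] by (simp add: m_def)
    qed
  qed
  also have "(\<Sum>S\<in>Pow J. m S * sum t S) = (\<Sum>S\<in>Pow J. \<Sum>j\<in>J. t j * (of_bool (j \<in> S) * m S))"
  proof (rule sum.cong[OF refl])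
    fix S assume "S \<in> Pow J"
    then have "sum t S = (\<Sum>j\<in>J. t j * of_bool (j \<in> S))"
      using J by (intro sum.mono_neutral_cong_left) auto
    then show "m S * sum t S = (\<Sum>j\<in>J. t j * (of_bool (j \<in> S) * m S))"
      by (simp add: sum_distrib_left mult_ac)
  qed
  also have "\<dots> = (\<Sum>j\<in>J. t j * (\<Sum>S\<in>Pow J. of_bool (j \<in> S) * m S))"
    by (subst sum.swap) (simp add: sum_distrib_left)
  also have "\<dots> = sum t J" using m_sum by simp
  finally show ?thesis .
qed

context group
begin

lemma translate_property_if_invariant_measure:
  fixes \<iota> :: "'a \<Rightarrow> 'x"
  assumes inj: "inj_on \<iota> (carrier G)"
    and \<phi>: "\<And>g x. g \<in> carrier G \<Longrightarrow> x \<in> carrier G \<Longrightarrow> \<phi> g (\<iota> x) = \<iota> (g \<otimes> x)"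
    and \<mu>: "invariant_fin_add_measure G (\<iota> ` carrier G) \<phi> \<mu>" "\<mu> (\<iota> ` A) = 1"
    and A: "A \<subseteq> carrier G" "A \<noteq> {}"
  shows "translate_property G (indicator A)"
  unfolding translate_property_def
proof (intro conjI allI impI)
  show "\<forall>x\<in>carrier G. 0 \<le> (indicator A x :: real)" by simp
  show "bounded (indicator A ` carrier G :: real set)"
    by (intro boundedI[of _ 1]) (auto simp: indicator_def)
  show "\<exists>x\<in>carrier G. indicator A x \<noteq> (0::real)" using A by (auto simp: indicator_def)
next
  fix n :: nat and t g
  assume g: "\<forall>i\<in>{1..n}. g i \<in> carrier G"
    and nonneg: "\<forall>x\<in>carrier G. 0 \<le> (\<Sum>i=1..n. t i * translate G (g i) (indicator A) x)"
  show "0 \<le> (\<Sum>i=1..n. t i)"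
  proof (rule fin_add_measure_combination_nonneg[of "\<iota> ` carrier G" \<mu> "{1..n}" "\<lambda>i. \<phi> (g i) ` \<iota> ` A"])
    show "positive (Pow (\<iota> ` carrier G)) \<mu>" "additive (Pow (\<iota> ` carrier G)) \<mu>"
      using \<mu>(1) by (auto simp: invariant_fin_add_measure_def)
    have im: "\<phi> (g i) ` \<iota> ` A = \<iota> ` (\<lambda>x. g i \<otimes> x) ` A" if "i \<in> {1..n}" for i
      unfolding image_image using g that A \<phi> by (intro image_cong) auto
    show "\<phi> (g i) ` \<iota> ` A \<subseteq> \<iota> ` carrier G \<and> \<mu> (\<phi> (g i) ` \<iota> ` A) = 1" if i: "i \<in> {1..n}" for i
    proof
      show "\<phi> (g i) ` \<iota> ` A \<subseteq> \<iota> ` carrier G" using im[OF i] g i A by auto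
      show "\<mu> (\<phi> (g i) ` \<iota> ` A) = 1"
        using \<mu> g i A(1) unfolding invariant_fin_add_measure_def by (metis image_mono)
    qed
    fix y assume "y \<in> \<iota> ` carrier G"
    then obtain x where x: "x \<in> carrier G" "y = \<iota> x" by blast
    have "indicator (\<phi> (g i) ` \<iota> ` A) y = (translate G (g i) (indicator A) x :: real)" if i: "i \<in> {1..n}" for i
    proof -
      have gi: "g i \<in> carrier G" using g i by blast
      have "y \<in> \<phi> (g i) ` \<iota> ` A \<longleftrightarrow> x \<in> (\<lambda>z. g i \<otimes> z) ` A"
      proof -
        have "(\<lambda>z. g i \<otimes> z) ` A \<subseteq> carrier G" using A gi by auto
        then show ?thesis unfolding im[OF i] using inj x by (simp add: inj_on_image_mem_iff)
      qed
      also have "\<dots> \<longleftrightarrow> inv (g i) \<otimes> x \<in> A"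
      proof
        assume "x \<in> (\<lambda>z. g i \<otimes> z) ` A"
        then obtain z where "z \<in> A" "x = g i \<otimes> z" by blast
        then show "inv (g i) \<otimes> x \<in> A" using A gi by (auto simp: m_assoc[symmetric] subset_iff)
      next
        assume "inv (g i) \<otimes> x \<in> A"
        moreover have "x = g i \<otimes> (inv (g i) \<otimes> x)" using gi x by (simp add: m_assoc[symmetric])
        ultimately show "x \<in> (\<lambda>z. g i \<otimes> z) ` A" by blast
      qed
      finally show ?thesis by (simp add: translate_def indicator_def)
    qed
    then show "0 \<le> (\<Sum>i\<in>{1..n}. t i * indicator (\<phi> (g i) ` \<iota> ` A) y)"
      using nonneg x by simp
  qed simp
qed

text \<open>
  The map \<open>\<iota>\<close> moves the regular action to a copy of the group inside another type.
\<close>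
lemma regular_action:
  fixes \<iota> :: "'a \<Rightarrow> 'x"
  assumes inj: "inj_on \<iota> (carrier G)"
  shows "\<exists>\<phi>. group_action G (\<iota> ` carrier G) \<phi> \<and>
    (\<forall>g\<in>carrier G. \<forall>x\<in>carrier G. \<phi> g (\<iota> x) = \<iota> (g \<otimes> x))"
proof -
  define \<phi> where "\<phi> g = (\<lambda>y\<in>\<iota> ` carrier G. \<iota> (g \<otimes> inv_into (carrier G) \<iota> y))" for g
  have \<phi>: "\<phi> g (\<iota> x) = \<iota> (g \<otimes> x)" if "g \<in> carrier G" "x \<in> carrier G" for g x
    using that inj by (simp add: \<phi>_def)
  have Bij: "\<phi> g \<in> Bij (\<iota> ` carrier G)" if g: "g \<in> carrier G" for g
    unfolding Bij_def
  proof
    show "\<phi> g \<in> extensional (\<iota> ` carrier G)" by (simp add: \<phi>_def)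
    have "bij_betw (\<phi> g) (\<iota> ` carrier G) (\<iota> ` carrier G)"
    proof (rule bij_betw_byWitness[of _ "\<phi> (inv g)"])
      show "\<forall>a\<in>\<iota> ` carrier G. \<phi> (inv g) (\<phi> g a) = a"
        using g by (auto simp: \<phi> m_assoc[symmetric])
      show "\<forall>a\<in>\<iota> ` carrier G. \<phi> g (\<phi> (inv g) a) = a"
        using g by (auto simp: \<phi> m_assoc[symmetric])
    qed (use g in \<open>auto simp: \<phi>\<close>)
    then show "\<phi> g \<in> {f. bij_betw f (\<iota> ` carrier G) (\<iota> ` carrier G)}" by simp
  qed
  have "group_hom G (BijGroup (\<iota> ` carrier G)) \<phi>"
  proof (intro group_hom.intro group_hom_axioms.intro homI)
    show "group G" by (rule is_group)
    show "group (BijGroup (\<iota> ` carrier G))" by (rule group_BijGroup)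
    show "\<phi> g \<in> carrier (BijGroup (\<iota> ` carrier G))" if "g \<in> carrier G" for g
      using Bij[OF that] by (simp add: BijGroup_def)
    show "\<phi> (g \<otimes> k) = \<phi> g \<otimes>\<^bsub>BijGroup (\<iota> ` carrier G)\<^esub> \<phi> k" if gk: "g \<in> carrier G" "k \<in> carrier G" for g k
    proof -
      have "\<phi> (g \<otimes> k) = compose (\<iota> ` carrier G) (\<phi> g) (\<phi> k)"
      proof (rule extensionalityI[of _ "\<iota> ` carrier G"])
        show "\<phi> (g \<otimes> k) \<in> extensional (\<iota> ` carrier G)" by (simp add: \<phi>_def)
        show "\<phi> (g \<otimes> k) y = compose (\<iota> ` carrier G) (\<phi> g) (\<phi> k) y" if "y \<in> \<iota> ` carrier G" for y
          using that gk by (auto simp: compose_def \<phi> m_assoc)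
      qed simp
      then show ?thesis using Bij gk by (simp add: BijGroup_def)
    qed
  qed
  then show ?thesis using \<phi> by (intro exI[of _ \<phi>]) (simp add: group_action_def)
qed

lemma supramenable_imp_translate_property_for_sets:
  fixes \<iota> :: "'a \<Rightarrow> 'x"
  assumes inj: "inj_on \<iota> (carrier G)" and supra: "supramenable TYPE('x) G"
  shows "translate_property_for_sets G"
  unfolding translate_property_for_sets_def
proof (intro allI impI)
  fix A assume A: "A \<subseteq> carrier G \<and> A \<noteq> {}"
  obtain \<phi> where \<phi>: "group_action G (\<iota> ` carrier G) \<phi>"
    "\<And>g x. g \<in> carrier G \<Longrightarrow> x \<in> carrier G \<Longrightarrow> \<phi> g (\<iota> x) = \<iota> (g \<otimes> x)"
    using regular_action[OF inj] by blast
  have "\<iota> ` A \<subseteq> \<iota> ` carrier G \<and> \<iota> ` A \<noteq> {}" using A by blast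
  then obtain \<mu> where "invariant_fin_add_measure G (\<iota> ` carrier G) \<phi> \<mu>" "\<mu> (\<iota> ` A) = 1"
    using supra[unfolded supramenable_def, rule_format, of "\<iota> ` carrier G" \<phi> "\<iota> ` A"] \<phi>(1) by auto
  then show "translate_property G (indicator A)"
    using translate_property_if_invariant_measure[OF inj \<phi>(2)] A by blast
qed

text \<open>
  The orbit map \<open>g \<mapsto> \<phi> g x\<close> is equivariant, so the image of an invariant measure is invariant.
\<close>
lemma orbit_measure:
  fixes X :: "'x set"
  assumes act: "group_action G X \<phi>" and x: "x \<in> X" and A: "A \<subseteq> X"
    and \<nu>: "invariant_fin_add_measure G (carrier G) (\<lambda>g y. g \<otimes> y) \<nu>"
      "\<nu> {g \<in> carrier G. \<phi> g x \<in> A} = 1"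
  shows "\<exists>\<mu>. invariant_fin_add_measure G X \<phi> \<mu> \<and> \<mu> A = 1"
proof -
  interpret act: group_action G X \<phi> by (rule act)
  define pre where "pre B = {g \<in> carrier G. \<phi> g x \<in> B}" for B
  have "\<nu> (pre (\<phi> g ` B)) = \<nu> (pre B)" if g: "g \<in> carrier G" and B: "B \<subseteq> X" for g B
  proof -
    have "pre (\<phi> g ` B) = (\<lambda>y. g \<otimes> y) ` pre B"
    proof (intro Set.set_eqI iffI)
      fix k assume "k \<in> pre (\<phi> g ` B)"
      then obtain b where k: "k \<in> carrier G" "b \<in> B" "\<phi> k x = \<phi> g b" by (auto simp: pre_def)
      have "\<phi> (inv g \<otimes> k) x = \<phi> (inv g) (\<phi> g b)"
        using act.composition_rule[OF x, of "inv g" k] g k by simp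
      also have "\<dots> = b" using act.orbit_sym_aux[OF g _ refl, of b] k B by blast
      finally have "inv g \<otimes> k \<in> pre B" using g k by (simp add: pre_def)
      moreover have "k = g \<otimes> (inv g \<otimes> k)" using g k by (simp add: m_assoc[symmetric])
      ultimately show "k \<in> (\<lambda>y. g \<otimes> y) ` pre B" by blast
    next
      fix k assume "k \<in> (\<lambda>y. g \<otimes> y) ` pre B"
      then obtain l where l: "l \<in> carrier G" "\<phi> l x \<in> B" "k = g \<otimes> l" by (auto simp: pre_def)
      then show "k \<in> pre (\<phi> g ` B)"
        using g act.composition_rule[OF x g l(1)] by (simp add: pre_def)
    qed
    moreover have "pre B \<subseteq> carrier G" by (auto simp: pre_def)
    ultimately show ?thesis using \<nu>(1) g by (auto simp: invariant_fin_add_measure_def)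
  qed
  moreover have "positive (Pow X) (\<lambda>B. \<nu> (pre B))"
    using \<nu>(1) by (auto simp: invariant_fin_add_measure_def positive_def pre_def)
  moreover have "additive (Pow X) (\<lambda>B. \<nu> (pre B))"
    unfolding additive_def
  proof (intro ballI impI)
    fix B C :: "'x set" assume "B \<inter> C = {}"
    then have "pre B \<inter> pre C = {}" "pre (B \<union> C) = pre B \<union> pre C"
      "pre B \<in> Pow (carrier G)" "pre C \<in> Pow (carrier G)" by (auto simp: pre_def)
    then show "\<nu> (pre (B \<union> C)) = \<nu> (pre B) + \<nu> (pre C)"
      using \<nu>(1) unfolding invariant_fin_add_measure_def additive_def by metis
  qed
  ultimately show ?thesis
    using \<nu>(2) by (intro exI[of _ "\<lambda>B. \<nu> (pre B)"]) (simp add: invariant_fin_add_measure_def pre_def)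
qed

lemma translate_property_for_sets_imp_supramenable:
  assumes tp: "translate_property_for_sets G"
  shows "supramenable TYPE('x) G"
  unfolding supramenable_def
proof (intro allI impI)
  fix X :: "'x set" and \<phi> A
  assume X: "group_action G X \<phi> \<and> A \<subseteq> X \<and> A \<noteq> {}"
  then interpret act: group_action G X \<phi> by simp
  obtain x where x: "x \<in> A" "x \<in> X" using X by blast
  define A' where "A' = {g \<in> carrier G. \<phi> g x \<in> A}"
  have "\<phi> \<one> x = x" using act.id_eq_one x(2) by (metis restrict_apply')
  then have "\<one> \<in> A'" using x by (simp add: A'_def)
  then have "A' \<subseteq> carrier G \<and> A' \<noteq> {}" by (auto simp: A'_def)
  then have "translate_property G (indicator A')"
    using tp unfolding translate_property_for_sets_def by blast
  moreover have "\<forall>S. finite S \<and> S \<subseteq> carrier G \<longrightarrow> has_almost_invariant_densities G S"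
    using translate_property_for_sets_imp_amenable[OF tp] by blast
  ultimately obtain \<nu> where "invariant_fin_add_measure G (carrier G) (\<lambda>g y. g \<otimes> y) \<nu>" "\<nu> A' = 1"
    using invariant_measure_if_translate_property by blast
  then show "\<exists>\<mu>. invariant_fin_add_measure G X \<phi> \<mu> \<and> \<mu> A = 1"
    using X x(2) orbit_measure[of X \<phi> x A \<nu>] unfolding A'_def by blast
qed

end

theorem corollary20:
  fixes G :: "('a, 'm) monoid_scheme"
  assumes "group G"
  shows "translate_property_for_sets G \<longleftrightarrow> supramenable TYPE('a + 'x) G"
proof
  interpret group G by (rule assms)
  show "supramenable TYPE('a + 'x) G" if "translate_property_for_sets G"
    using that by (rule translate_property_for_sets_imp_supramenable)
  show "translate_property_for_sets G" if "supramenable TYPE('a + 'x) G"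
    using supramenable_imp_translate_property_for_sets[of "Inl :: 'a \<Rightarrow> 'a + 'x"] that by simp
qed

end
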